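(* Let $k\ge1$, $t\in\mathbb{R}$ and $f\in C^\infty(\mathbb{R})$. For all $0\le\alpha\le1$ and $\alpha\le\mu\le\frac{(k+1)(k+2)}{2}$, there exists a set $E=E_{\alpha,\mu,f,t}\subset J^k(\mathbb{R})$ with $\dim_{\mathrm{Hau}}J_{f,t}(E)=\alpha$ and $\dim_{\mathrm{Hau}}E=\mu$.
   Context: Let $k\ge 1$ be an integer. The jet space Carnot group $J^k(\mathbb{R})$ is the set $\mathbb{R}^{k+2}$, with points written $(x,u_k,\ldots,u_0)$, equipped with the group operation $(x,u_k,\ldots,u_0)\odot(y,v_k,\ldots,v_0)=(x+y,w_k,\ldots,w_0)$, where $w_k=u_k+v_k$ and $w_s=u_s+v_s+\sum_{j=s+1}^k u_j\frac{y^{j-s}}{(j-s)!}$ for $s=0,\ldots,k-1$. The horizontal bundle is framed by the left-invariant vector fields $X^{(k)}=\frac{\partial}{\partial x}+u_k\frac{\partial}{\partial u_{k-1}}+\cdots+u_1\frac{\partial}{\partial u_0}$ and $\frac{\partial}{\partial u_k}$, declared orthonormal; a horizontal curve is a curve that is absolutely continuous into $\mathbb{R}^{k+2}$ and whose derivative lies a.e. in the horizontal bundle. The Carnot–Carathéodory distance $d_{cc}(p,q)$ is the infimum of lengths of horizontal curves connecting $p$ to $q$. $\dim_{\mathrm{Hau}}$ of subsets of $J^k(\mathbb{R})$ is Hausdorff dimension with respect to $d_{cc}$ (with $\dim_{\mathrm{Hau}}\emptyset=0$). For $f\in C^\infty(\mathbb{R})$ and $x\in\mathbb{R}$, $j^k_x(f):=j^k(f)(x):=(x,f^{(k)}(x),f^{(k-1)}(x),\ldots,f(x))\in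 J^k(\mathbb{R})$, and $\mathrm{im}(j^k(f)):=\{j^k_x(f):x\in\mathbb{R}\}$. For $f\in C^\infty(\mathbb{R})$ and $t\in\mathbb{R}$, the horizontal mapping is $J_{f,t}:J^k(\mathbb{R})\to\mathrm{im}(j^k(f))$, $J_{f,t}(x,u_k,\ldots,u_0):=j^k_{x-t}(f)$. *)

theory Defs
  imports "HOL-Analysis.Analysis"
begin

section \<open>Hausdorff dimension with respect to a distance function\<close>

text \<open>The distance takes values in \<^typ>\<open>ennreal\<close>, so that it can be defined as an infimum that is
  infinite when taken over the empty set. \<open>X\<close> is the underlying space.\<close>

definition diam_wrt :: "('a \<Rightarrow> 'a \<Rightarrow> ennreal) \<Rightarrow> 'a set \<Rightarrow> ennreal" where
  "diam_wrt d U = (SUP (p, q) \<in> U \<times> U. d p q)"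

text \<open>The \<open>s\<close>-th power of the diameter, with the usual conventions that the empty set contributes
  \<open>0\<close> and that nonempty sets contribute \<open>1\<close> for \<open>s = 0\<close> (note that \<open>0 powr 0 = 0\<close>). It is only
  used for sets of finite diameter.\<close>

definition diam_power :: "('a \<Rightarrow> 'a \<Rightarrow> ennreal) \<Rightarrow> real \<Rightarrow> 'a set \<Rightarrow> ennreal" where
  "diam_power d s U =
     (if U = {} then 0 else if s = 0 then 1 else ennreal (enn2real (diam_wrt d U) powr s))"

definition hausdorff_premeasure ::
    "'a set \<Rightarrow> ('a \<Rightarrow> 'a \<Rightarrow> ennreal) \<Rightarrow> real \<Rightarrow> real \<Rightarrow> 'a set \<Rightarrow> ennreal" where
  "hausdorff_premeasure X d s \<delta> A =
     (INF U \<in> {U :: nat \<Rightarrow> 'a set. (\<forall>i. U i \<subseteq> X \<and> diam_wrt d (U i) \<le> ennreal \<delta>) \<and> A \<subseteq> (\<Union>i. U i)}.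
        \<Sum>i. diam_power d s (U i))"

definition hausdorff_measure ::
    "'a set \<Rightarrow> ('a \<Rightarrow> 'a \<Rightarrow> ennreal) \<Rightarrow> real \<Rightarrow> 'a set \<Rightarrow> ennreal" where
  "hausdorff_measure X d s A = (SUP \<delta> \<in> {0<..}. hausdorff_premeasure X d s \<delta> A)"

definition hausdorff_dim :: "'a set \<Rightarrow> ('a \<Rightarrow> 'a \<Rightarrow> ennreal) \<Rightarrow> 'a set \<Rightarrow> ennreal" where
  "hausdorff_dim X d A = (INF s \<in> {s. 0 \<le> s \<and> hausdorff_measure X d s A = 0}. ennreal s)"


section \<open>Real analysis\<close>

definition abs_continuous_on_interval :: "real \<Rightarrow> real \<Rightarrow> (real \<Rightarrow> real) \<Rightarrow> bool" where
  "abs_continuous_on_interval a b g \<longleftrightarrow>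
     (\<forall>\<epsilon>>0. \<exists>\<delta>>0. \<forall>I. finite I \<longrightarrow> (\<forall>(c, d) \<in> I. a \<le> c \<and> c \<le> d \<and> d \<le> b) \<longrightarrow>
        disjoint_family_on (\<lambda>(c, d). {c<..<d}) I \<longrightarrow> (\<Sum>(c, d) \<in> I. d - c) < \<delta> \<longrightarrow>
        (\<Sum>(c, d) \<in> I. \<bar>g d - g c\<bar>) < \<epsilon>)"

definition smooth :: "(real \<Rightarrow> real) \<Rightarrow> bool" where
  "smooth f \<longleftrightarrow> (\<forall>n x. (deriv ^^ n) f differentiable at x)"


section \<open>The jet space Carnot group\<close>

text \<open>The point \<open>(x, u\<^sub>k, \<dots>, u\<^sub>0)\<close> is encoded as \<open>(x, u)\<close> with \<open>u j\<close> for the coordinate \<open>u\<^sub>j\<close>, and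
  \<open>u j = 0\<close> for the unused indices \<open>j > k\<close>. Tangent vectors are encoded in the same way.\<close>

type_synonym jet = "real \<times> (nat \<Rightarrow> real)"

definition jet_space :: "nat \<Rightarrow> jet set" where
  "jet_space k = {(x, u). \<forall>j>k. u j = 0}"

text \<open>For \<open>s = k\<close> the sum is empty.\<close>

definition jet_mult :: "nat \<Rightarrow> jet \<Rightarrow> jet \<Rightarrow> jet" where
  "jet_mult k p q =
     (fst p + fst q,
      \<lambda>s. if s \<le> k
          then snd p s + snd q s + (\<Sum>j = s+1..k. snd p j * fst q ^ (j - s) / fact (j - s))
          else 0)"

definition jet_X :: "nat \<Rightarrow> jet \<Rightarrow> jet" where
  "jet_X k p = (1, \<lambda>j. if j < k then snd p (j + 1) else 0)"

definition jet_U :: "nat \<Rightarrow> jet \<Rightarrow> jet" where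
  "jet_U k p = (0, \<lambda>j. if j = k then 1 else 0)"

definition horizontal_vector :: "nat \<Rightarrow> jet \<Rightarrow> real \<Rightarrow> real \<Rightarrow> jet" where
  "horizontal_vector k p c d =
     (c * fst (jet_X k p) + d * fst (jet_U k p),
      \<lambda>j. c * snd (jet_X k p) j + d * snd (jet_U k p) j)"

definition horizontal_space :: "nat \<Rightarrow> jet \<Rightarrow> jet set" where
  "horizontal_space k p = {horizontal_vector k p c d | c d. True}"

definition has_jet_derivative :: "(real \<Rightarrow> jet) \<Rightarrow> jet \<Rightarrow> real \<Rightarrow> bool" where
  "has_jet_derivative \<gamma> v t \<longleftrightarrow>
     ((\<lambda>\<tau>. fst (\<gamma> \<tau>)) has_real_derivative fst v) (at t) \<and>
     (\<forall>j. ((\<lambda>\<tau>. snd (\<gamma> \<tau>) j) has_real_derivative snd v j) (at t))"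

text \<open>Absolute continuity into the finite-dimensional space is absolute continuity of each
  coordinate. Only the restriction of \<open>\<gamma>\<close> to \<open>{a..b}\<close> matters, the end points being a null set.\<close>

definition horizontal_curve :: "nat \<Rightarrow> real \<Rightarrow> real \<Rightarrow> (real \<Rightarrow> jet) \<Rightarrow> bool" where
  "horizontal_curve k a b \<gamma> \<longleftrightarrow>
     a \<le> b \<and> \<gamma> ` {a..b} \<subseteq> jet_space k \<and>
     abs_continuous_on_interval a b (\<lambda>\<tau>. fst (\<gamma> \<tau>)) \<and>
     (\<forall>j\<le>k. abs_continuous_on_interval a b (\<lambda>\<tau>. snd (\<gamma> \<tau>) j)) \<and>
     (AE \<tau> in lebesgue. \<tau> \<in> {a..b} \<longrightarrow>
        (\<exists>v \<in> horizontal_space k (\<gamma> \<tau>). has_jet_derivative \<gamma> v \<tau>))"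

text \<open>The coefficients of a horizontal vector with respect to the orthonormal frame
  \<^const>\<open>jet_X\<close>, \<^const>\<open>jet_U\<close> are its \<open>x\<close>- and \<open>u\<^sub>k\<close>-components.\<close>

lemma horizontal_vector_components:
  "fst (horizontal_vector k p c d) = c" "snd (horizontal_vector k p c d) k = d"
  by (simp_all add: horizontal_vector_def jet_X_def jet_U_def)

definition horizontal_length :: "nat \<Rightarrow> real \<Rightarrow> real \<Rightarrow> (real \<Rightarrow> jet) \<Rightarrow> ennreal" where
  "horizontal_length k a b \<gamma> =
     (\<integral>\<^sup>+ \<tau> \<in> {a..b}. ennreal (sqrt ((deriv (\<lambda>s. fst (\<gamma> s)) \<tau>)\<^sup>2 + (deriv (\<lambda>s. snd (\<gamma> s) k) \<tau>)\<^sup>2))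
        \<partial>lebesgue)"

definition cc_dist :: "nat \<Rightarrow> jet \<Rightarrow> jet \<Rightarrow> ennreal" where
  "cc_dist k p q =
     (INF (a, b, \<gamma>) \<in> {(a, b, \<gamma>). horizontal_curve k a b \<gamma> \<and> \<gamma> a = p \<and> \<gamma> b = q}.
        horizontal_length k a b \<gamma>)"

abbreviation jet_hausdorff_dim :: "nat \<Rightarrow> jet set \<Rightarrow> ennreal" where
  "jet_hausdorff_dim k \<equiv> hausdorff_dim (jet_space k) (cc_dist k)"

text \<open>The frame is left-invariant: left translations map horizontal vectors to horizontal vectors
  with the same coefficients.\<close>

lemma left_translation_horizontal:
  assumes D: "has_jet_derivative \<gamma> (horizontal_vector k (\<gamma> t) c d) t"
  shows "has_jet_derivative (\<lambda>\<tau>. jet_mult k p (\<gamma> \<tau>))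
           (horizontal_vector k (jet_mult k p (\<gamma> t)) c d) t"
proof -
  let ?w = "\<lambda>s \<tau>. snd p s + snd (\<gamma> \<tau>) s
              + (\<Sum>j = s+1..k. snd p j * fst (\<gamma> \<tau>) ^ (j - s) / fact (j - s))"
  have D1: "((\<lambda>\<tau>. fst (\<gamma> \<tau>)) has_real_derivative c) (at t)"
    using D by (simp add: has_jet_derivative_def horizontal_vector_components)
  have D2: "((\<lambda>\<tau>. snd (\<gamma> \<tau>) s) has_real_derivative
      (if s < k then c * snd (\<gamma> t) (s + 1) else 0) + (if s = k then d else 0)) (at t)" for s
    using D by (auto simp: has_jet_derivative_def horizontal_vector_def jet_X_def jet_U_def
        dest!: spec[of _ s] split: if_splits)
  have pow: "((\<lambda>\<tau>. snd p j * fst (\<gamma> \<tau>) ^ (j - s) / fact (j - s)) has_real_derivative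
      c * (snd p j * fst (\<gamma> t) ^ (j - Suc s) / fact (j - Suc s))) (at t)" if "j \<in> {s+1..k}" for j s
  proof -
    obtain n where n: "j - s = Suc n" "j - Suc s = n" 
      using \<open>j \<in> {s+1..k}\<close> by (intro that[of "j - Suc s"]) auto
    have "((\<lambda>\<tau>. snd p j * fst (\<gamma> \<tau>) ^ Suc n / fact (Suc n)) has_real_derivative
        snd p j * ((1 + of_nat n) * (c * fst (\<gamma> t) ^ n)) / fact (Suc n)) (at t)"
      by (rule DERIV_cdivide[OF DERIV_cmult[OF DERIV_power_Suc[OF D1]]])
    also have "snd p j * ((1 + of_nat n) * (c * fst (\<gamma> t) ^ n)) / fact (Suc n)
        = c * (snd p j * fst (\<gamma> t) ^ n / fact n)"
      by (simp add: divide_simps)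
    finally show ?thesis unfolding n .
  qed
  have main: "(?w s has_real_derivative
      (if s < k then c * ?w (s + 1) t else 0) + (if s = k then d else 0)) (at t)" if "s \<le> k" for s
  proof -
    have "(?w s has_real_derivative 0 + ((if s < k then c * snd (\<gamma> t) (s + 1) else 0)
        + (if s = k then d else 0))
        + (\<Sum>j = s+1..k. c * (snd p j * fst (\<gamma> t) ^ (j - Suc s) / fact (j - Suc s)))) (at t)"
      by (rule DERIV_add[OF DERIV_add[OF DERIV_const D2] DERIV_sum[OF pow]])
    moreover have "(\<Sum>j = s+1..k. c * (snd p j * fst (\<gamma> t) ^ (j - Suc s) / fact (j - Suc s)))
       = (if s < k then c * (snd p (s + 1) +
            (\<Sum>j = s+1+1..k. snd p j * fst (\<gamma> t) ^ (j - (s+1)) / fact (j - (s+1)))) else 0)"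
      using that by (auto simp: sum.atLeast_Suc_atMost[of "Suc s" k] sum_distrib_left distrib_left)
    ultimately show ?thesis
      by (auto simp: algebra_simps split: if_splits)
  qed
  have "((\<lambda>\<tau>. snd (jet_mult k p (\<gamma> \<tau>)) s) has_real_derivative
      snd (horizontal_vector k (jet_mult k p (\<gamma> t)) c d) s) (at t)" for s
    using main[of s]
    by (cases "s \<le> k"; cases "s < k")
       (simp_all add: jet_mult_def horizontal_vector_def jet_X_def jet_U_def)
  moreover have "((\<lambda>\<tau>. fst (jet_mult k p (\<gamma> \<tau>))) has_real_derivative c) (at t)"
    using D1 by (auto simp: jet_mult_def intro!: derivative_eq_intros)
  ultimately show ?thesis
    by (simp add: has_jet_derivative_def horizontal_vector_components)
qed


section \<open>Jets and the horizontal mapping\<close>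

definition jet :: "nat \<Rightarrow> (real \<Rightarrow> real) \<Rightarrow> real \<Rightarrow> jet" where
  "jet k f x = (x, \<lambda>j. if j \<le> k then (deriv ^^ j) f x else 0)"

definition horizontal_map :: "nat \<Rightarrow> (real \<Rightarrow> real) \<Rightarrow> real \<Rightarrow> jet \<Rightarrow> jet" where
  "horizontal_map k f t p = jet k f (fst p - t)"

end

theory Submission
  imports Defs
begin

text \<open>
  The horizontal mapping sees only the first coordinate \<open>x\<close>, so adding a subset of a fiber of \<open>x\<close>
  to a set adds at most a point to its image, but may raise its dimension. So \<open>E\<close> is taken
  as a union \<open>E1 \<union> E2\<close>. The set \<open>E1\<close> consists of the points \<open>(x, 0)\<close> with \<open>x\<close> in a Cantor-type set
  \<open>S \<subseteq> \<real>\<close> of dimension \<open>\<alpha>\<close> containing \<open>0\<close> (for \<open>\<alpha> = 0\<close> just \<open>{0}\<close>), and \<open>E2\<close> is a subset of dimension \<open>\<mu>\<close> of the fiber over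
  \<open>x = 0\<close>. The image of \<open>E\<close> is then the part of the jet of \<open>f\<close> over \<open>S - t\<close>. Both this image and \<open>E1\<close>
  lie on jets of smooth functions, where the Carnot-Caratheodory distance is locally comparable
  with \<open>\<bar>x - x'\<bar>\<close>, so both have dimension \<open>\<alpha>\<close>, and \<open>\<alpha> \<le> \<mu>\<close> makes \<open>E\<close> of dimension \<open>\<mu>\<close>.

  On the fiber over \<open>0\<close> the distance is comparable with \<open>max\<^sub>j \<bar>u\<^sub>j - v\<^sub>j\<bar> powr (1 / (k + 1 - j))\<close>
  (\<open>fiber_diff_le_cc_dist\<close> and \<open>cc_dist_fiber_le\<close>). The product over \<open>j\<close> of copies of one Cantor-type
  set of dimension \<open>\<sigma> \<le> 1\<close> therefore has dimension \<open>\<sigma> * (1 + 2 + \<dots> + (k + 1))\<close>, which runs through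
  the whole range of \<open>\<mu>\<close>.
  The lower estimate holds because an absolutely continuous function changes by no more than the
  integral of its speed (\<open>abs_continuous_increment_le\<close>), applied successively to the coordinates
  \<open>u\<^sub>k, u\<^sub>k\<^sub>-\<^sub>1, \<dots>\<close> of a left-translated curve. For the upper estimate, two fiber points \<open>u\<close> and \<open>v\<close> are
  joined by following the jet of one polynomial from \<open>x = 0\<close> to \<open>x = r\<close> and the jet of another one
  back to \<open>x = 0\<close>; the second is a polynomial of degree at most \<open>k\<close> with jet \<open>v\<close> at \<open>0\<close>, and the
  first interpolates between the jet \<open>u\<close> at \<open>0\<close> and the jet of the second at \<open>r\<close>.

  The Cantor-type sets are ranges of explicit strictly increasing functions
  (\<open>staircase_exists\<close>). Their inverses are Hoelder continuous onto an interval, so that covers of the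
  fractal become covers of a cube in Lebesgue measure (\<open>hausdorff_measure_neq_0I\<close>), while the images
  of dyadic intervals provide efficient covers (\<open>hausdorff_measure_eq_0I\<close>).
\<close>


section \<open>Absolutely continuous functions\<close>

text \<open>The innermost statement of \<^const>\<open>abs_continuous_on_interval\<close>, named so that it can be handled
  without unfolding the quantifier over families of intervals.\<close>

definition increments_below :: "real \<Rightarrow> real \<Rightarrow> (real \<Rightarrow> real) \<Rightarrow> real \<Rightarrow> real \<Rightarrow> bool" where
  "increments_below a b g \<delta> \<epsilon> \<longleftrightarrow>
     (\<forall>I. finite I \<longrightarrow> (\<forall>(c, d) \<in> I. a \<le> c \<and> c \<le> d \<and> d \<le> b) \<longrightarrow>
        disjoint_family_on (\<lambda>(c, d). {c<..<d}) I \<longrightarrow> (\<Sum>(c, d) \<in> I. d - c) < \<delta> \<longrightarrow>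
        (\<Sum>(c, d) \<in> I. \<bar>g d - g c\<bar>) < \<epsilon>)"

lemma abs_continuous_on_interval_iff:
  "abs_continuous_on_interval a b g \<longleftrightarrow> (\<forall>\<epsilon>>0. \<exists>\<delta>>0. increments_below a b g \<delta> \<epsilon>)"
  by (simp add: abs_continuous_on_interval_def increments_below_def)

lemma increments_belowD:
  assumes "increments_below a b g \<delta> \<epsilon>" "finite I" "\<And>c d. (c, d) \<in> I \<Longrightarrow> a \<le> c \<and> c \<le> d \<and> d \<le> b"
    "disjoint_family_on (\<lambda>(c, d). {c<..<d}) I" "(\<Sum>(c, d) \<in> I. d - c) < \<delta>"
  shows "(\<Sum>(c, d) \<in> I. \<bar>g d - g c\<bar>) < \<epsilon>"
  using assms(1)[unfolded increments_below_def, rule_format, OF assms(2) _ assms(4,5)] assms(3) by auto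

lemma increments_belowI:
  assumes "\<And>I. finite I \<Longrightarrow> (\<And>c d. (c, d) \<in> I \<Longrightarrow> a \<le> c \<and> c \<le> d \<and> d \<le> b) \<Longrightarrow>
    disjoint_family_on (\<lambda>(c, d). {c<..<d}) I \<Longrightarrow> (\<Sum>(c, d) \<in> I. d - c) < \<delta> \<Longrightarrow>
    (\<Sum>(c, d) \<in> I. \<bar>g d - g c\<bar>) < \<epsilon>"
  shows "increments_below a b g \<delta> \<epsilon>"
  unfolding increments_below_def
proof (intro allI impI)
  fix I assume *: "finite I" "\<forall>(c, d) \<in> I. a \<le> c \<and> c \<le> d \<and> d \<le> b"
    "disjoint_family_on (\<lambda>(c, d). {c<..<d}) I" "(\<Sum>(c, d) \<in> I. d - c) < \<delta>"
  show "(\<Sum>(c, d) \<in> I. \<bar>g d - g c\<bar>) < \<epsilon>"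
    by (rule assms[OF *(1) _ *(3,4)]) (use *(2) in blast)
qed

lemma abs_continuous_on_interval_subset:
  assumes "abs_continuous_on_interval a b g" "a \<le> a'" "b' \<le> b"
  shows "abs_continuous_on_interval a' b' g"
  unfolding abs_continuous_on_interval_iff
proof (intro allI impI)
  fix \<epsilon> :: real assume "\<epsilon> > 0"
  then obtain \<delta> where \<delta>: "\<delta> > 0" "increments_below a b g \<delta> \<epsilon>"
    using assms(1) unfolding abs_continuous_on_interval_iff by blast
  have "increments_below a' b' g \<delta> \<epsilon>"
    by (rule increments_belowI, rule increments_belowD[OF \<delta>(2)]) (use assms(2,3) in force)+
  then show "\<exists>\<delta>>0. increments_below a' b' g \<delta> \<epsilon>" using \<delta>(1) by blast
qed

text \<open>The one closure property from which sums, multiples, powers and Lipschitz functions follow.\<close>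

lemma abs_continuous_on_interval_dominated:
  assumes f: "abs_continuous_on_interval a b f" and g: "abs_continuous_on_interval a b g"
    and le: "\<And>c d. a \<le> c \<Longrightarrow> c \<le> d \<Longrightarrow> d \<le> b \<Longrightarrow> \<bar>w d - w c\<bar> \<le> K * (\<bar>f d - f c\<bar> + \<bar>g d - g c\<bar>)"
  shows "abs_continuous_on_interval a b w"
  unfolding abs_continuous_on_interval_iff
proof (intro allI impI)
  fix \<epsilon> :: real assume "\<epsilon> > 0"
  define K' where "K' = max K 1"
  have K': "K' > 0" "K \<le> K'" by (auto simp: K'_def)
  have e: "\<epsilon> / (2 * K') > 0" using K' \<open>\<epsilon> > 0\<close> by simp
  obtain \<delta>1 where d1: "\<delta>1 > 0" "increments_below a b f \<delta>1 (\<epsilon> / (2 * K'))"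
    using f e unfolding abs_continuous_on_interval_iff by blast
  obtain \<delta>2 where d2: "\<delta>2 > 0" "increments_below a b g \<delta>2 (\<epsilon> / (2 * K'))"
    using g e unfolding abs_continuous_on_interval_iff by blast
  have "increments_below a b w (min \<delta>1 \<delta>2) \<epsilon>"
  proof (rule increments_belowI)
    fix I :: "(real \<times> real) set"
    assume I: "finite I" "\<And>c d. (c, d) \<in> I \<Longrightarrow> a \<le> c \<and> c \<le> d \<and> d \<le> b"
      "disjoint_family_on (\<lambda>(c, d). {c<..<d}) I" "(\<Sum>(c, d) \<in> I. d - c) < min \<delta>1 \<delta>2"
    have "(\<Sum>(c, d) \<in> I. \<bar>w d - w c\<bar>) \<le> (\<Sum>(c, d) \<in> I. K' * (\<bar>f d - f c\<bar> + \<bar>g d - g c\<bar>))"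
    proof (rule sum_mono, clarify)
      fix c d assume "(c, d) \<in> I"
      then have "\<bar>w d - w c\<bar> \<le> K * (\<bar>f d - f c\<bar> + \<bar>g d - g c\<bar>)" using I(2) le by auto
      also have "\<dots> \<le> K' * (\<bar>f d - f c\<bar> + \<bar>g d - g c\<bar>)" by (intro mult_right_mono K') auto
      finally show "\<bar>w d - w c\<bar> \<le> K' * (\<bar>f d - f c\<bar> + \<bar>g d - g c\<bar>)" .
    qed
    also have "\<dots> = K' * ((\<Sum>(c, d) \<in> I. \<bar>f d - f c\<bar>) + (\<Sum>(c, d) \<in> I. \<bar>g d - g c\<bar>))"
      by (simp add: sum_distrib_left sum.distrib[symmetric] case_prod_unfold)
    also have "\<dots> < K' * (\<epsilon> / (2 * K') + \<epsilon> / (2 * K'))"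
      by (intro mult_strict_left_mono add_strict_mono increments_belowD[OF d1(2)] increments_belowD[OF d2(2)] K') (use I in auto)
    also have "\<dots> = \<epsilon>" using K' by (simp add: field_simps)
    finally show "(\<Sum>(c, d) \<in> I. \<bar>w d - w c\<bar>) < \<epsilon>" .
  qed
  then show "\<exists>\<delta>>0. increments_below a b w \<delta> \<epsilon>" using d1(1) d2(1) by (intro exI[of _ "min \<delta>1 \<delta>2"]) simp
qed

lemma abs_continuous_on_interval_ident: "abs_continuous_on_interval a b (\<lambda>x. x)"
  unfolding abs_continuous_on_interval_iff
proof (intro allI impI)
  fix \<epsilon> :: real assume "\<epsilon> > 0"
  have "increments_below a b (\<lambda>x. x) \<epsilon> \<epsilon>"
  proof (rule increments_belowI)
    fix I :: "(real \<times> real) set"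
    assume I: "\<And>c d. (c, d) \<in> I \<Longrightarrow> a \<le> c \<and> c \<le> d \<and> d \<le> b" "(\<Sum>(c, d) \<in> I. d - c) < \<epsilon>"
    have "(\<Sum>(c, d) \<in> I. \<bar>d - c\<bar>) = (\<Sum>(c, d) \<in> I. d - c)"
      by (rule sum.cong) (use I(1) in auto)
    then show "(\<Sum>(c, d) \<in> I. \<bar>d - c\<bar>) < \<epsilon>" using I(2) by simp
  qed
  then show "\<exists>\<delta>>0. increments_below a b (\<lambda>x. x) \<delta> \<epsilon>" using \<open>\<epsilon> > 0\<close> by blast
qed

lemma lipschitz_imp_abs_continuous_on_interval:
  assumes "\<And>c d. a \<le> c \<Longrightarrow> c \<le> d \<Longrightarrow> d \<le> b \<Longrightarrow> \<bar>w d - w c\<bar> \<le> K * (d - c)"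
  shows "abs_continuous_on_interval a b w"
proof (rule abs_continuous_on_interval_dominated[OF abs_continuous_on_interval_ident abs_continuous_on_interval_ident, where K = "\<bar>K\<bar>"])
  fix c d assume *: "a \<le> c" "c \<le> d" "d \<le> b"
  have "\<bar>w d - w c\<bar> \<le> K * (d - c)" using assms * by simp
  also have "\<dots> \<le> \<bar>K\<bar> * (\<bar>d - c\<bar> + \<bar>d - c\<bar>)" using *
    by (intro mult_mono) auto
  finally show "\<bar>w d - w c\<bar> \<le> \<bar>K\<bar> * (\<bar>d - c\<bar> + \<bar>d - c\<bar>)" .
qed

text \<open>The Henstock-Kurzweil gauge is chosen according to the tag. At a point of differentiability it
  makes the straddle estimate hold, exactly as for everywhere differentiable functions. At a point of
  \<open>N\<close> it keeps the interval inside an open set of small measure, and absolute continuity bounds the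
  total increment of \<open>g\<close> over all such intervals.\<close>

lemma abs_continuous_fundamental_theorem:
  assumes ac: "abs_continuous_on_interval a b g" and "a \<le> b"
    and null: "N \<in> null_sets lebesgue"
    and D: "\<And>x. x \<in> {a..b} - N \<Longrightarrow> (g has_real_derivative g' x) (at x)"
  shows "((\<lambda>x. if x \<in> N then 0 else g' x) has_integral (g b - g a)) {a..b}"
proof -
  define \<phi> where "\<phi> = (\<lambda>x. if x \<in> N then 0 else g' x)"
  have "(\<phi> has_integral (g b - g a)) (cbox a b)"
    unfolding has_integral
  proof (intro allI impI)
    fix e :: real assume "e > 0"
    \<comment> \<open>The summand \<open>1\<close> keeps the denominator positive when \<open>a = b\<close>.\<close>
    define e' where "e' = e / (4 * (b - a + 1))"
    have "e' > 0" using \<open>e > 0\<close> \<open>a \<le> b\<close> by (simp add: e'_def)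
    have "\<exists>d>0. x \<in> {a..b} - N \<longrightarrow>
        (\<forall>y. norm (y-x) < d \<longrightarrow> norm (g y - g x - (y-x) * \<phi> x) \<le> e' * norm (y-x))" for x
    proof (cases "x \<in> {a..b} - N")
      case True
      then have "(g has_derivative (\<lambda>h. h * \<phi> x)) (at x)" using D[OF True]
        by (simp add: \<phi>_def has_field_derivative_def mult_commute_abs)
      then show ?thesis using \<open>e' > 0\<close> unfolding has_derivative_at_alt by auto
    qed (auto intro: exI[of _ 1])
    then obtain d where d: "\<And>x. d x > 0" "\<And>x y. x \<in> {a..b} - N \<Longrightarrow> norm (y-x) < d x \<Longrightarrow>
        norm (g y - g x - (y-x) * \<phi> x) \<le> e' * norm (y-x)" by metis
    have "e / 2 > 0" using \<open>e > 0\<close> by simp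
    obtain \<delta> where \<delta>: "\<delta> > 0" "increments_below a b g \<delta> (e / 2)"
      using ac \<open>e / 2 > 0\<close> unfolding abs_continuous_on_interval_iff by blast
    have "N \<in> sets lebesgue" using null by (rule null_setsD2)
    obtain T where T: "open T" "N \<subseteq> T" "emeasure lebesgue (T - N) < ennreal \<delta>"
      by (rule sets_lebesgue_outer_open[OF \<open>N \<in> sets lebesgue\<close> \<delta>(1)])
    have "emeasure lebesgue T = emeasure lebesgue (T - N)"
      using null T(1) by (intro emeasure_Diff_null_set[symmetric]) auto
    then have T3: "emeasure lborel T < ennreal \<delta>" using T by simp
    have "\<forall>x\<in>N. \<exists>r>0. ball x r \<subseteq> T" using T(1,2) by (meson open_contains_ball subsetD)
    then obtain r where r: "\<And>x. x \<in> N \<Longrightarrow> r x > 0 \<and> ball x (r x) \<subseteq> T" by metis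
    define R where "R = (\<lambda>x. if x \<in> N then r x else d x)"
    have R: "R x > 0" for x using r d by (auto simp: R_def)
    show "\<exists>\<gamma>. gauge \<gamma> \<and> (\<forall>\<D>. \<D> tagged_division_of (cbox a b) \<and> \<gamma> fine \<D> \<longrightarrow>
        norm ((\<Sum>(x,K)\<in>\<D>. measure lborel K *\<^sub>R \<phi> x) - (g b - g a)) < e)"
    proof (intro exI[of _ "\<lambda>x. ball x (R x)"] conjI allI impI)
      show "gauge (\<lambda>x. ball x (R x))" using R by (intro gauge_ball_dependent) auto
      fix p assume p: "p tagged_division_of (cbox a b) \<and> (\<lambda>x. ball x (R x)) fine p"
      then have ptag: "p tagged_division_of {a..b}" and fine: "(\<lambda>x. ball x (R x)) fine p" by auto
      have fin: "finite p" using ptag by auto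
      have K: "\<exists>u v. K = {u..v} \<and> u \<le> x \<and> x \<le> v \<and> a \<le> u \<and> v \<le> b \<and> {u..v} \<subseteq> ball x (R x)" if xK: "(x, K) \<in> p" for x K
      proof -
        obtain u v where uv: "K = {u..v}" using tagged_division_ofD(4)[OF ptag xK] by auto
        moreover have "x \<in> K" "K \<subseteq> {a..b}" using ptag xK by auto
        moreover have "K \<subseteq> ball x (R x)" using fine xK by (auto simp: fine_def)
        ultimately show ?thesis by (intro exI[of _ u] exI[of _ v]) auto
      qed
      define E where "E = (\<lambda>(x, K). measure lborel K *\<^sub>R \<phi> x - (g (Sup K) - g (Inf K)))"
      have "(\<Sum>(x,K)\<in>p. measure lborel K *\<^sub>R \<phi> x) - (g b - g a) = (\<Sum>z\<in>p. E z)"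
        using additive_tagged_division_1[OF \<open>a \<le> b\<close> ptag, of g]
        by (simp add: E_def sum_subtractf case_prod_unfold)
      also have "norm \<dots> \<le> (\<Sum>z\<in>p. norm (E z))" by (rule norm_sum)
      also have "\<dots> \<le> (\<Sum>z\<in>p. (case z of (x, K) \<Rightarrow> e' * (Sup K - Inf K)) + (case z of (x, K) \<Rightarrow> if x \<in> N then \<bar>g (Sup K) - g (Inf K)\<bar> else 0))"
      proof (rule sum_mono, clarify)
        fix x S assume xS: "(x, S) \<in> p"
        then obtain u v where uv: "S = {u..v}" "u \<le> x" "x \<le> v" "a \<le> u" "v \<le> b" "{u..v} \<subseteq> ball x (R x)"
          using K by blast
        have IS: "Inf S = u" "Sup S = v" "measure lborel S = v - u" using uv by auto
        show "norm (E (x, S)) \<le> e' * (Sup S - Inf S) + (if x \<in> N then \<bar>g (Sup S) - g (Inf S)\<bar> else 0)"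
        proof (cases "x \<in> N")
          case True
          moreover have "0 \<le> e' * (v - u)" using uv \<open>e' > 0\<close> by simp
          ultimately show ?thesis using IS by (simp add: E_def \<phi>_def abs_minus_commute)
        next
          case False
          have "u \<in> {u..v}" "v \<in> {u..v}" using uv by auto
          then have in_ball: "u \<in> ball x (R x)" "v \<in> ball x (R x)" using uv(6) by blast+
          have "norm (g u - g x - (u - x) * \<phi> x) \<le> e' * norm (u - x)"
            "norm (g v - g x - (v - x) * \<phi> x) \<le> e' * norm (v - x)"
          proof -
            have "x \<in> {a..b} - N" using False uv by auto
            moreover have "norm (u - x) < d x" "norm (v - x) < d x"
              using in_ball False by (auto simp: R_def dist_real_def)
            ultimately show "norm (g u - g x - (u - x) * \<phi> x) \<le> e' * norm (u - x)"
              "norm (g v - g x - (v - x) * \<phi> x) \<le> e' * norm (v - x)" using d(2) by blast+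
          qed
          moreover have "E (x, S) = (g u - g x - (u - x) * \<phi> x) - (g v - g x - (v - x) * \<phi> x)"
            by (simp add: E_def IS algebra_simps)
          ultimately have "norm (E (x, S)) \<le> e' * norm (u - x) + e' * norm (v - x)" by simp
          also have "\<dots> = e' * (v - u)" using uv by (simp add: algebra_simps)
          finally show ?thesis using False IS by simp
        qed
      qed
      also have "\<dots> = e' * (b - a) + (\<Sum>(x, K)\<in>p. if x \<in> N then \<bar>g (Sup K) - g (Inf K)\<bar> else 0)"
        using additive_tagged_division_1[OF \<open>a \<le> b\<close> ptag, of "\<lambda>x. x"]
        by (simp add: sum.distrib sum_distrib_left[symmetric] case_prod_unfold)
      also have "(\<Sum>(x, K)\<in>p. if x \<in> N then \<bar>g (Sup K) - g (Inf K)\<bar> else 0) < e / 2"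
      proof -
        \<comment> \<open>Degenerate intervals contribute nothing and are dropped: they alone could give the same
          pair of end points for different tags.\<close>
        define q where "q = {(x, K) \<in> p. x \<in> N \<and> Inf K < Sup K}"
        define \<pi> where "\<pi> = (\<lambda>(x :: real, K :: real set). (Inf K, Sup K))"
        have qp: "q \<subseteq> p" by (auto simp: q_def)
        have to_q: "(\<Sum>(x, K)\<in>p. if x \<in> N then \<bar>g (Sup K) - g (Inf K)\<bar> else 0) = (\<Sum>(x, K)\<in>q. \<bar>g (Sup K) - g (Inf K)\<bar>)"
        proof (rule sum.mono_neutral_cong_right[OF fin qp])
          show "\<forall>i\<in>p - q. (case i of (x, K) \<Rightarrow> if x \<in> N then \<bar>g (Sup K) - g (Inf K)\<bar> else 0) = 0"
          proof clarify
            fix x S assume xS: "(x, S) \<in> p" "(x, S) \<notin> q"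
            then obtain u v where uv: "S = {u..v}" "u \<le> x" "x \<le> v" using K by blast
            show "(if x \<in> N then \<bar>g (Sup S) - g (Inf S)\<bar> else 0) = 0"
              using xS uv by (cases "u < v") (auto simp: q_def not_less dest: order_antisym)
          qed
        qed (auto simp: q_def)
        have interiors: "{u<..<v} \<inter> {u'<..<v'} = {}"
          if "(x, S) \<in> q" "(x', S') \<in> q" "(x, S) \<noteq> (x', S')" "S = {u..v}" "S' = {u'..v'}" for x S x' S' u v u' v'
          using tagged_division_ofD(5)[OF ptag, of x S x' S'] that qp by auto
        have qK: "\<exists>u v. K = {u..v} \<and> u < v \<and> u \<le> x \<and> x \<le> v \<and> a \<le> u \<and> v \<le> b \<and> {u..v} \<subseteq> T" if xK: "(x, K) \<in> q" for x K
        proof -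
          from xK have "(x, K) \<in> p" "x \<in> N" "Inf K < Sup K" by (auto simp: q_def)
          obtain u v where uv: "K = {u..v}" "u \<le> x" "x \<le> v" "a \<le> u" "v \<le> b" "{u..v} \<subseteq> ball x (R x)"
            using K[OF \<open>(x, K) \<in> p\<close>] by blast
          moreover have "ball x (R x) \<subseteq> T" using r[OF \<open>x \<in> N\<close>] \<open>x \<in> N\<close> by (simp add: R_def)
          moreover have "u < v" using \<open>Inf K < Sup K\<close> uv by auto
          ultimately show ?thesis by (intro exI[of _ u] exI[of _ v]) auto
        qed
        have inj: "inj_on \<pi> q"
        proof (rule inj_onI, clarify)
          fix x S x' S' assume h: "(x, S) \<in> q" "(x', S') \<in> q" "\<pi> (x, S) = \<pi> (x', S')"
          obtain u v where uv: "S = {u..v}" "u < v" using qK[OF h(1)] by blast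
          obtain u' v' where uv': "S' = {u'..v'}" "u' < v'" using qK[OF h(2)] by blast
          have "u = u'" "v = v'" using h(3) uv uv' by (auto simp: \<pi>_def)
          moreover have "{u<..<v} \<noteq> {}" using uv(2) by simp
          ultimately show "x = x' \<and> S = S'"
            using interiors[OF h(1,2) _ uv(1) uv'(1)] by fastforce
        qed
        have ord: "a \<le> c \<and> c \<le> d \<and> d \<le> b" if "(c, d) \<in> \<pi> ` q" for c d
        proof -
          from that obtain x S where xS: "(x, S) \<in> q" "c = Inf S" "d = Sup S" by (auto simp: \<pi>_def)
          then show ?thesis using qK[OF xS(1)] by auto
        qed
        have disj: "disjoint_family_on (\<lambda>(c, d). {c<..<d}) (\<pi> ` q)"
          unfolding disjoint_family_on_def
        proof (intro ballI impI)
          fix z1 z2 assume h: "z1 \<in> \<pi> ` q" "z2 \<in> \<pi> ` q" "z1 \<noteq> z2"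
          then obtain x S x' S' where e: "(x, S) \<in> q" "(x', S') \<in> q" "z1 = \<pi> (x, S)" "z2 = \<pi> (x', S')" by auto
          obtain u v where uv: "S = {u..v}" "u < v" using qK[OF e(1)] by blast
          obtain u' v' where uv': "S' = {u'..v'}" "u' < v'" using qK[OF e(2)] by blast
          have "(x, S) \<noteq> (x', S')" using h(3) e by auto
          from interiors[OF e(1,2) this uv(1) uv'(1)]
          show "(case z1 of (c, d) \<Rightarrow> {c<..<d}) \<inter> (case z2 of (c, d) \<Rightarrow> {c<..<d}) = {}"
            using uv uv' by (simp add: e \<pi>_def)
        qed
        have finq: "finite (\<pi> ` q)" using fin qp finite_subset by blast
        have "ennreal (\<Sum>(c, d)\<in>\<pi> ` q. d - c) = (\<Sum>(c, d)\<in>\<pi> ` q. ennreal (d - c))"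
          using ord by (subst sum_ennreal[symmetric]) (auto simp: case_prod_unfold)
        also have "\<dots> = (\<Sum>z\<in>\<pi> ` q. emeasure lborel ((\<lambda>(c, d). {c<..<d}) z))"
          using ord by (intro sum.cong) auto
        also have "\<dots> = emeasure lborel (\<Union>z\<in>\<pi> ` q. (\<lambda>(c, d). {c<..<d}) z)"
          by (intro sum_emeasure disj finq) auto
        also have "\<dots> \<le> emeasure lborel T"
        proof (rule emeasure_mono)
          show "(\<Union>z\<in>\<pi> ` q. (\<lambda>(c, d). {c<..<d}) z) \<subseteq> T"
          proof (rule UN_least)
            fix z assume "z \<in> \<pi> ` q"
            then obtain x S where e: "(x, S) \<in> q" "z = \<pi> (x, S)" by auto
            from qK[OF e(1)] show "(\<lambda>(c, d). {c<..<d}) z \<subseteq> T" by (auto simp: e \<pi>_def subset_iff)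
          qed
        qed (use T in auto)
        also have "\<dots> < ennreal \<delta>" by (rule T3)
        finally have "(\<Sum>(c, d)\<in>\<pi> ` q. d - c) < \<delta>"
          using \<delta>(1) by (simp add: ennreal_less_iff ennreal_lessI) (metis ennreal_leI not_le)
        from increments_belowD[OF \<delta>(2) finq ord disj this] have "(\<Sum>(c, d)\<in>\<pi> ` q. \<bar>g d - g c\<bar>) < e / 2" by auto
        also have "(\<Sum>(c, d)\<in>\<pi> ` q. \<bar>g d - g c\<bar>) = (\<Sum>(x, K)\<in>q. \<bar>g (Sup K) - g (Inf K)\<bar>)"
          by (subst sum.reindex[OF inj]) (simp add: \<pi>_def case_prod_unfold)
        finally show ?thesis using to_q by simp
      qed
      also have "e' * (b - a) + e / 2 < e"
      proof -
        have "e' * (b - a) \<le> e / 4" using \<open>a \<le> b\<close> \<open>e > 0\<close>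
          by (simp add: e'_def field_simps)
        then show ?thesis using \<open>e > 0\<close> by simp
      qed
      finally show "norm ((\<Sum>(x,K)\<in>p. measure lborel K *\<^sub>R \<phi> x) - (g b - g a)) < e" by simp
    qed
  qed
  then show ?thesis by (simp add: \<phi>_def)
qed

text \<open>The bound \<open>h\<close> is arbitrary, not only measurable, so that it can be instantiated with a speed
  given by \<^const>\<open>deriv\<close>. If its integral is finite, the Henstock-Kurzweil integral of the derivative
  is a Lebesgue integral and the triangle inequality applies.\<close>

lemma abs_continuous_increment_le:
  assumes ac: "abs_continuous_on_interval a b g" and "a \<le> b"
    and AE: "AE x in lebesgue. x \<in> {a..b} \<longrightarrow> (\<exists>D. (g has_real_derivative D) (at x) \<and> ennreal \<bar>D\<bar> \<le> h x)"
  shows "ennreal \<bar>g b - g a\<bar> \<le> (\<integral>\<^sup>+x\<in>{a..b}. h x \<partial>lebesgue)"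
proof (cases "(\<integral>\<^sup>+x\<in>{a..b}. h x \<partial>lebesgue) = \<infinity>")
  case False
  define P where "P = (\<lambda>x. x \<in> {a..b} \<longrightarrow> (\<exists>D. (g has_real_derivative D) (at x) \<and> ennreal \<bar>D\<bar> \<le> h x))"
  have "AE x in lebesgue. P x" using AE by (simp add: P_def)
  then obtain N where N: "N \<in> null_sets lebesgue" "{x \<in> space lebesgue. \<not> P x} \<subseteq> N"
    unfolding eventually_ae_filter by blast
  have "\<exists>D. (g has_real_derivative D) (at x) \<and> ennreal \<bar>D\<bar> \<le> h x" if "x \<in> {a..b} - N" for x
  proof -
    have "P x" using N(2) that by auto
    then show ?thesis using that by (simp add: P_def)
  qed
  then obtain g' where g': "\<And>x. x \<in> {a..b} - N \<Longrightarrow> (g has_real_derivative g' x) (at x) \<and> ennreal \<bar>g' x\<bar> \<le> h x"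
    by metis
  define \<phi> where "\<phi> = (\<lambda>x. if x \<in> N then 0 else g' x)"
  have I: "(\<phi> has_integral (g b - g a)) {a..b}"
    unfolding \<phi>_def by (rule abs_continuous_fundamental_theorem[OF ac \<open>a \<le> b\<close> N(1)]) (use g' in auto)
  define \<Phi> where "\<Phi> = (\<lambda>x. if x \<in> {a..b} then \<phi> x else 0)"
  have "\<phi> \<in> borel_measurable (lebesgue_on {a..b})"
    using I by (intro integrable_imp_measurable) auto
  then have meas: "\<Phi> \<in> borel_measurable lebesgue"
    unfolding \<Phi>_def by (subst borel_measurable_if_I) auto
  have I': "(\<Phi> has_integral (g b - g a)) UNIV"
    unfolding \<Phi>_def using I by (subst has_integral_restrict_UNIV)
  have le: "(\<integral>\<^sup>+x. ennreal (norm (\<Phi> x)) \<partial>lebesgue) \<le> (\<integral>\<^sup>+x\<in>{a..b}. h x \<partial>lebesgue)"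
  proof (rule nn_integral_mono)
    fix x show "ennreal (norm (\<Phi> x)) \<le> h x * indicator {a..b} x"
      using g'[of x] by (auto simp: \<Phi>_def \<phi>_def)
  qed
  then have "integrable lebesgue \<Phi>"
    using meas False by (intro integrableI_bounded) (auto simp: less_top[symmetric] top_unique)
  then have "(\<Phi> has_integral (integral\<^sup>L lebesgue \<Phi>)) UNIV" by (rule has_integral_integral_lebesgue)
  then have "integral\<^sup>L lebesgue \<Phi> = g b - g a" using I' has_integral_unique by blast
  then show ?thesis using integral_norm_bound_ennreal[OF \<open>integrable lebesgue \<Phi>\<close>] le by simp
qed simp

lemma abs_continuous_on_interval_const: "abs_continuous_on_interval a b (\<lambda>x. c)"
  by (rule lipschitz_imp_abs_continuous_on_interval[where K = 0]) simp

lemma abs_continuous_on_interval_add: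
  assumes "abs_continuous_on_interval a b f" "abs_continuous_on_interval a b g"
  shows "abs_continuous_on_interval a b (\<lambda>x. f x + g x)"
  by (rule abs_continuous_on_interval_dominated[OF assms, where K = 1]) simp

lemma abs_continuous_on_interval_cmult:
  assumes "abs_continuous_on_interval a b f"
  shows "abs_continuous_on_interval a b (\<lambda>x. c * f x)"
proof (rule abs_continuous_on_interval_dominated[OF assms assms, where K = "\<bar>c\<bar>"])
  fix x y
  have "\<bar>c * f y - c * f x\<bar> = \<bar>c\<bar> * \<bar>f y - f x\<bar>"
    by (simp add: abs_mult[symmetric] right_diff_distrib)
  also have "\<dots> \<le> \<bar>c\<bar> * (\<bar>f y - f x\<bar> + \<bar>f y - f x\<bar>)" by (intro mult_left_mono) auto
  finally show "\<bar>c * f y - c * f x\<bar> \<le> \<bar>c\<bar> * (\<bar>f y - f x\<bar> + \<bar>f y - f x\<bar>)" .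
qed

lemma abs_continuous_on_interval_sum:
  assumes "\<And>i. i \<in> I \<Longrightarrow> abs_continuous_on_interval a b (f i)"
  shows "abs_continuous_on_interval a b (\<lambda>x. \<Sum>i\<in>I. f i x)"
  using assms
  by (induction I rule: infinite_finite_induct)
     (auto intro: abs_continuous_on_interval_const abs_continuous_on_interval_add)

lemma abs_continuous_on_interval_power:
  assumes f: "abs_continuous_on_interval a b f" and B: "\<And>x. x \<in> {a..b} \<Longrightarrow> \<bar>f x\<bar> \<le> B"
  shows "abs_continuous_on_interval a b (\<lambda>x. f x ^ n)"
proof (induction n)
  case (Suc n)
  show ?case
  proof (rule abs_continuous_on_interval_dominated[OF f Suc, where K = "B + B ^ n"])
    fix c d assume cd: "a \<le> c" "c \<le> d" "d \<le> b"
    have Bc: "\<bar>f c\<bar> \<le> B" and Bd: "\<bar>f d\<bar> \<le> B" using cd by (auto intro: B)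
    then have "0 \<le> B" by linarith
    have pw: "\<bar>f c ^ n\<bar> \<le> B ^ n" using Bc by (simp add: power_abs power_mono)
    have "f d ^ Suc n - f c ^ Suc n = f d * (f d ^ n - f c ^ n) + f c ^ n * (f d - f c)"
      by (simp add: algebra_simps)
    then have "\<bar>f d ^ Suc n - f c ^ Suc n\<bar> \<le> \<bar>f d\<bar> * \<bar>f d ^ n - f c ^ n\<bar> + \<bar>f c ^ n\<bar> * \<bar>f d - f c\<bar>"
      by (metis abs_mult abs_triangle_ineq)
    also have "\<dots> \<le> B * \<bar>f d ^ n - f c ^ n\<bar> + B ^ n * \<bar>f d - f c\<bar>"
      by (intro add_mono mult_right_mono Bd pw) auto
    also have "\<dots> \<le> (B + B ^ n) * (\<bar>f d - f c\<bar> + \<bar>f d ^ n - f c ^ n\<bar>)"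
      using \<open>0 \<le> B\<close> by (simp add: algebra_simps)
    finally show "\<bar>f d ^ Suc n - f c ^ Suc n\<bar> \<le> (B + B ^ n) * (\<bar>f d - f c\<bar> + \<bar>f d ^ n - f c ^ n\<bar>)" .
  qed
qed (simp add: abs_continuous_on_interval_const)

text \<open>The integral is a supremum over simple functions, and those below \<open>c * f\<close> are multiples of those
  below \<open>f\<close>, whether or not \<open>f\<close> is measurable. Speeds given by \<^const>\<open>deriv\<close> are only known
  to be derivatives almost everywhere.\<close>

lemma nn_integral_cmult_le:
  assumes "0 < c"
  shows "(\<integral>\<^sup>+x. ennreal c * f x \<partial>M) \<le> ennreal c * (\<integral>\<^sup>+x. f x \<partial>M)"
  unfolding nn_integral_def[of M "\<lambda>x. ennreal c * f x"]
proof (rule SUP_least)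
  fix g assume "g \<in> {g. simple_function M g \<and> g \<le> (\<lambda>x. ennreal c * f x)}"
  then have g: "simple_function M g" "\<And>x. g x \<le> ennreal c * f x" by (auto simp: le_fun_def)
  have inv: "ennreal (inverse c) * ennreal c = 1"
    using assms by (simp add: ennreal_mult[symmetric])
  define g' where "g' x = ennreal (inverse c) * g x" for x
  have g': "simple_function M g'" unfolding g'_def using g(1) by (intro simple_function_mult simple_function_const)
  have "g = (\<lambda>x. ennreal c * g' x)"
    using inv by (auto simp: g'_def mult.assoc[symmetric] mult.commute)
  then have "integral\<^sup>S M g = ennreal c * integral\<^sup>S M g'" using simple_integral_mult[OF g'] by simp
  also have "integral\<^sup>S M g' \<le> (\<integral>\<^sup>+x. f x \<partial>M)"
    unfolding nn_integral_def
  proof (rule SUP_upper)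
    have "g' x \<le> f x" for x
    proof -
      have "g' x \<le> ennreal (inverse c) * (ennreal c * f x)"
        unfolding g'_def by (intro mult_left_mono g) auto
      also have "\<dots> = f x" by (simp add: mult.assoc[symmetric] inv)
      finally show ?thesis .
    qed
    then show "g' \<in> {g. simple_function M g \<and> g \<le> f}" using g' by (auto simp: le_fun_def)
  qed
  finally show "integral\<^sup>S M g \<le> ennreal c * (\<integral>\<^sup>+x. f x \<partial>M)" by (simp add: mult_left_mono)
qed

lemma abs_continuous_increment_le_mult:
  assumes ac: "abs_continuous_on_interval a b g" and t: "t \<in> {a..b}" and "0 < R" "0 < r"
    and AE: "AE x in lebesgue. x \<in> {a..b} \<longrightarrow>
      (\<exists>D. (g has_real_derivative D) (at x) \<and> ennreal \<bar>D\<bar> \<le> ennreal R * h x)"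
    and len: "(\<integral>\<^sup>+x\<in>{a..b}. h x \<partial>lebesgue) \<le> ennreal r"
  shows "\<bar>g t - g a\<bar> \<le> R * r"
proof -
  have "ennreal \<bar>g t - g a\<bar> \<le> (\<integral>\<^sup>+x\<in>{a..t}. ennreal R * h x \<partial>lebesgue)"
  proof (rule abs_continuous_increment_le)
    show "abs_continuous_on_interval a t g" using ac by (rule abs_continuous_on_interval_subset) (use t in auto)
    show "AE x in lebesgue. x \<in> {a..t} \<longrightarrow> (\<exists>D. (g has_real_derivative D) (at x) \<and> ennreal \<bar>D\<bar> \<le> ennreal R * h x)"
      by (rule AE_mp[OF AE], rule AE_I2) (use t in auto)
  qed (use t in auto)
  also have "\<dots> \<le> (\<integral>\<^sup>+x. ennreal R * (h x * indicator {a..b} x) \<partial>lebesgue)"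
    by (intro nn_integral_mono) (use t in \<open>auto simp: indicator_def\<close>)
  also have "\<dots> \<le> ennreal R * (\<integral>\<^sup>+x\<in>{a..b}. h x \<partial>lebesgue)" by (rule nn_integral_cmult_le) fact
  also have "\<dots> \<le> ennreal R * ennreal r" by (intro mult_left_mono len) auto
  also have "\<dots> = ennreal (R * r)" using assms by (simp add: ennreal_mult)
  finally show ?thesis using \<open>0 < R\<close> \<open>0 < r\<close> by (simp add: ennreal_le_iff)
qed


section \<open>Lower bounds for the Carnot-Caratheodory distance\<close>

text \<open>A horizontal curve starting at the origin satisfies \<open>w\<^sub>j' = c * w\<^sub>j\<^sub>+\<^sub>1\<close>, where \<open>\<bar>c\<bar>\<close> is at most the
  speed. Each integration gains one factor of the length, beginning with the coordinate \<open>w\<^sub>k\<close>, whose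
  derivative is itself at most the speed.\<close>

lemma horizontal_lift_bound:
  fixes w :: "real \<Rightarrow> nat \<Rightarrow> real"
  assumes ac: "\<And>j. j \<le> k \<Longrightarrow> abs_continuous_on_interval a b (\<lambda>\<tau>. w \<tau> j)" and "0 < r"
    and AE: "AE \<tau> in lebesgue. \<tau> \<in> {a..b} \<longrightarrow> (\<exists>c d. ennreal \<bar>c\<bar> \<le> h \<tau> \<and> ennreal \<bar>d\<bar> \<le> h \<tau> \<and>
      ((\<lambda>\<tau>. w \<tau> k) has_real_derivative d) (at \<tau>) \<and>
      (\<forall>j<k. ((\<lambda>\<tau>. w \<tau> j) has_real_derivative c * w \<tau> (Suc j)) (at \<tau>)))"
    and start: "\<And>j. j \<le> k \<Longrightarrow> w a j = 0"
    and len: "(\<integral>\<^sup>+\<tau>\<in>{a..b}. h \<tau> \<partial>lebesgue) \<le> ennreal r"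
  shows "i \<le> k \<Longrightarrow> t \<in> {a..b} \<Longrightarrow> \<bar>w t (k - i)\<bar> \<le> r ^ Suc i"
proof (induction i arbitrary: t)
  case 0
  have "\<bar>w t k - w a k\<bar> \<le> 1 * r"
    by (rule abs_continuous_increment_le_mult[OF ac 0(2) _ \<open>0 < r\<close> _ len], simp, simp)
       (rule AE_mp[OF AE], rule AE_I2, auto)
  then show ?case using start by simp
next
  case (Suc i)
  define j where "j = k - Suc i"
  have j: "j < k" "Suc j = k - i" using Suc.prems by (auto simp: j_def)
  have "\<bar>w t j - w a j\<bar> \<le> r ^ Suc i * r"
  proof (rule abs_continuous_increment_le_mult[OF ac Suc.prems(2) _ \<open>0 < r\<close> _ len])
    show "AE \<tau> in lebesgue. \<tau> \<in> {a..b} \<longrightarrow>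
      (\<exists>D. ((\<lambda>\<tau>. w \<tau> j) has_real_derivative D) (at \<tau>) \<and> ennreal \<bar>D\<bar> \<le> ennreal (r ^ Suc i) * h \<tau>)"
    proof (rule AE_mp[OF AE], rule AE_I2, intro impI)
      fix \<tau> assume *: "\<tau> \<in> {a..b} \<longrightarrow> (\<exists>c d. ennreal \<bar>c\<bar> \<le> h \<tau> \<and> ennreal \<bar>d\<bar> \<le> h \<tau> \<and>
        ((\<lambda>\<tau>. w \<tau> k) has_real_derivative d) (at \<tau>) \<and>
        (\<forall>j<k. ((\<lambda>\<tau>. w \<tau> j) has_real_derivative c * w \<tau> (Suc j)) (at \<tau>)))" and \<tau>: "\<tau> \<in> {a..b}"
      then obtain c where c: "ennreal \<bar>c\<bar> \<le> h \<tau>" "((\<lambda>\<tau>. w \<tau> j) has_real_derivative c * w \<tau> (Suc j)) (at \<tau>)"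
        using j(1) by blast
      have "\<bar>w \<tau> (Suc j)\<bar> \<le> r ^ Suc i" unfolding j(2) using Suc.IH[OF _ \<tau>] Suc.prems(1) by simp
      then have "ennreal \<bar>c * w \<tau> (Suc j)\<bar> \<le> ennreal (r ^ Suc i * \<bar>c\<bar>)"
        by (intro ennreal_leI) (simp add: abs_mult mult.commute[of _ "\<bar>c\<bar>"] mult_left_mono)
      also have "\<dots> = ennreal (r ^ Suc i) * ennreal \<bar>c\<bar>" using \<open>0 < r\<close> by (intro ennreal_mult) auto
      also have "\<dots> \<le> ennreal (r ^ Suc i) * h \<tau>" by (intro mult_left_mono c) auto
      finally show "\<exists>D. ((\<lambda>\<tau>. w \<tau> j) has_real_derivative D) (at \<tau>) \<and> ennreal \<bar>D\<bar> \<le> ennreal (r ^ Suc i) * h \<tau>"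
        using c(2) by blast
    qed
  qed (use j \<open>0 < r\<close> in auto)
  then show ?case using start[of j] j by (simp add: j_def[symmetric] mult.commute)
qed

text \<open>The coefficients of the velocity are recovered from the two components that enter the length.\<close>

lemma horizontal_curve_AE:
  assumes "horizontal_curve k a b \<gamma>"
  shows "AE \<tau> in lebesgue. \<tau> \<in> {a..b} \<longrightarrow> (\<exists>c d. has_jet_derivative \<gamma> (horizontal_vector k (\<gamma> \<tau>) c d) \<tau> \<and>
    max (ennreal \<bar>c\<bar>) (ennreal \<bar>d\<bar>) \<le> ennreal (sqrt ((deriv (\<lambda>s. fst (\<gamma> s)) \<tau>)\<^sup>2 + (deriv (\<lambda>s. snd (\<gamma> s) k) \<tau>)\<^sup>2)))"
proof -
  have "AE \<tau> in lebesgue. \<tau> \<in> {a..b} \<longrightarrow> (\<exists>v \<in> horizontal_space k (\<gamma> \<tau>). has_jet_derivative \<gamma> v \<tau>)"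
    using assms by (simp add: horizontal_curve_def)
  then show ?thesis
  proof (rule AE_mp, intro AE_I2 impI)
    fix \<tau> assume "\<tau> \<in> {a..b} \<longrightarrow> (\<exists>v \<in> horizontal_space k (\<gamma> \<tau>). has_jet_derivative \<gamma> v \<tau>)" "\<tau> \<in> {a..b}"
    then obtain c d where D: "has_jet_derivative \<gamma> (horizontal_vector k (\<gamma> \<tau>) c d) \<tau>"
      by (auto simp: horizontal_space_def)
    have "((\<lambda>s. fst (\<gamma> s)) has_real_derivative c) (at \<tau>)" "((\<lambda>s. snd (\<gamma> s) k) has_real_derivative d) (at \<tau>)"
      using D unfolding has_jet_derivative_def by (metis horizontal_vector_components)+
    then have "deriv (\<lambda>s. fst (\<gamma> s)) \<tau> = c" "deriv (\<lambda>s. snd (\<gamma> s) k) \<tau> = d" by (auto intro: DERIV_imp_deriv)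
    then show "\<exists>c d. has_jet_derivative \<gamma> (horizontal_vector k (\<gamma> \<tau>) c d) \<tau> \<and>
    max (ennreal \<bar>c\<bar>) (ennreal \<bar>d\<bar>) \<le> ennreal (sqrt ((deriv (\<lambda>s. fst (\<gamma> s)) \<tau>)\<^sup>2 + (deriv (\<lambda>s. snd (\<gamma> s) k) \<tau>)\<^sup>2))"
      using D by (intro exI[of _ c] exI[of _ d]) (auto intro!: ennreal_leI)
  qed
qed

lemma horizontal_curve_fst_le:
  assumes \<gamma>: "horizontal_curve k a b \<gamma>" and len: "horizontal_length k a b \<gamma> \<le> ennreal r" "0 < r" and t: "t \<in> {a..b}"
  shows "\<bar>fst (\<gamma> t) - fst (\<gamma> a)\<bar> \<le> r"
proof -
  have "\<bar>fst (\<gamma> t) - fst (\<gamma> a)\<bar> \<le> 1 * r"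
  proof (rule abs_continuous_increment_le_mult[OF _ t _ \<open>0 < r\<close> _ len(1)[unfolded horizontal_length_def]])
    show "abs_continuous_on_interval a b (\<lambda>\<tau>. fst (\<gamma> \<tau>))" using \<gamma> by (simp add: horizontal_curve_def)
    show "AE x in lebesgue. x \<in> {a..b} \<longrightarrow> (\<exists>D. ((\<lambda>\<tau>. fst (\<gamma> \<tau>)) has_real_derivative D) (at x) \<and>
      ennreal \<bar>D\<bar> \<le> ennreal 1 * ennreal (sqrt ((deriv (\<lambda>s. fst (\<gamma> s)) x)\<^sup>2 + (deriv (\<lambda>s. snd (\<gamma> s) k) x)\<^sup>2)))"
      by (rule AE_mp[OF horizontal_curve_AE[OF \<gamma>]], intro AE_I2 impI)
         (auto simp: has_jet_derivative_def horizontal_vector_components)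
  qed simp
  then show ?thesis by simp
qed

text \<open>Left translation by the inverse \<open>(0, - u)\<close> of the initial point \<open>(0, u)\<close> moves the curve to the
  origin without changing its speed. At the end point, where \<open>x = 0\<close> again, the translation acts on
  the coordinates by plain subtraction.\<close>

lemma horizontal_curve_fiber_le:
  assumes \<gamma>: "horizontal_curve k a b \<gamma>" and len: "horizontal_length k a b \<gamma> \<le> ennreal r" "0 < r"
    and fiber: "fst (\<gamma> a) = 0" "fst (\<gamma> b) = 0" and "j \<le> k"
  shows "\<bar>snd (\<gamma> b) j - snd (\<gamma> a) j\<bar> \<le> r ^ (k + 1 - j)"
proof -
  define p where "p = (0 :: real, \<lambda>s. - snd (\<gamma> a) s)"
  define w where "w \<tau> = snd (jet_mult k p (\<gamma> \<tau>))" for \<tau>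
  define h where "h \<tau> = ennreal (sqrt ((deriv (\<lambda>s. fst (\<gamma> s)) \<tau>)\<^sup>2 + (deriv (\<lambda>s. snd (\<gamma> s) k) \<tau>)\<^sup>2))" for \<tau>
  have "a \<le> b" using \<gamma> by (simp add: horizontal_curve_def)
  have w: "w \<tau> s = snd p s + snd (\<gamma> \<tau>) s + (\<Sum>j = s+1..k. (snd p j / fact (j - s)) * fst (\<gamma> \<tau>) ^ (j - s))" if "s \<le> k" for \<tau> s
    using that by (simp add: w_def jet_mult_def)
  have at_0: "w \<tau> s = snd (\<gamma> \<tau>) s - snd (\<gamma> a) s" if "s \<le> k" "fst (\<gamma> \<tau>) = 0" for \<tau> s
    using that by (auto simp: w p_def intro!: sum.neutral)
  have "\<bar>w b (k - (k - j))\<bar> \<le> r ^ Suc (k - j)"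
  proof (rule horizontal_lift_bound[where h = h and w = w and a = a and b = b])
    fix s assume s: "s \<le> k"
    have "\<bar>fst (\<gamma> \<tau>)\<bar> \<le> r" if "\<tau> \<in> {a..b}" for \<tau>
      using horizontal_curve_fst_le[OF \<gamma> len that] fiber by simp
    then show "abs_continuous_on_interval a b (\<lambda>\<tau>. w \<tau> s)"
      unfolding w[OF s] using \<gamma> s
      by (intro abs_continuous_on_interval_add abs_continuous_on_interval_sum abs_continuous_on_interval_const
          abs_continuous_on_interval_cmult abs_continuous_on_interval_power[where B = r])
         (auto simp: horizontal_curve_def)
    show "w a s = 0" using at_0[OF s fiber(1)] by simp
  next
    show "AE \<tau> in lebesgue. \<tau> \<in> {a..b} \<longrightarrow> (\<exists>c d. ennreal \<bar>c\<bar> \<le> h \<tau> \<and> ennreal \<bar>d\<bar> \<le> h \<tau> \<and>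
      ((\<lambda>\<tau>. w \<tau> k) has_real_derivative d) (at \<tau>) \<and>
      (\<forall>j<k. ((\<lambda>\<tau>. w \<tau> j) has_real_derivative c * w \<tau> (Suc j)) (at \<tau>)))"
    proof (rule AE_mp[OF horizontal_curve_AE[OF \<gamma>]], intro AE_I2 impI)
      fix \<tau> assume "\<tau> \<in> {a..b}" and "\<tau> \<in> {a..b} \<longrightarrow> (\<exists>c d. has_jet_derivative \<gamma> (horizontal_vector k (\<gamma> \<tau>) c d) \<tau> \<and>
    max (ennreal \<bar>c\<bar>) (ennreal \<bar>d\<bar>) \<le> ennreal (sqrt ((deriv (\<lambda>s. fst (\<gamma> s)) \<tau>)\<^sup>2 + (deriv (\<lambda>s. snd (\<gamma> s) k) \<tau>)\<^sup>2)))"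
      then obtain c d where cd: "has_jet_derivative \<gamma> (horizontal_vector k (\<gamma> \<tau>) c d) \<tau>"
        "max (ennreal \<bar>c\<bar>) (ennreal \<bar>d\<bar>) \<le> h \<tau>" unfolding h_def by blast
      have D: "((\<lambda>\<tau>. w \<tau> s) has_real_derivative snd (horizontal_vector k (jet_mult k p (\<gamma> \<tau>)) c d) s) (at \<tau>)" for s
        using left_translation_horizontal[OF cd(1), of p] by (simp add: has_jet_derivative_def w_def)
      have "((\<lambda>\<tau>. w \<tau> k) has_real_derivative d) (at \<tau>)" using D[of k] by (simp add: horizontal_vector_components)
      moreover have "((\<lambda>\<tau>. w \<tau> s) has_real_derivative c * w \<tau> (Suc s)) (at \<tau>)" if "s < k" for s
        using D[of s] that by (simp add: horizontal_vector_def jet_X_def jet_U_def w_def)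
      ultimately show "\<exists>c d. ennreal \<bar>c\<bar> \<le> h \<tau> \<and> ennreal \<bar>d\<bar> \<le> h \<tau> \<and>
        ((\<lambda>\<tau>. w \<tau> k) has_real_derivative d) (at \<tau>) \<and>
        (\<forall>j<k. ((\<lambda>\<tau>. w \<tau> j) has_real_derivative c * w \<tau> (Suc j)) (at \<tau>))"
        using cd(2) by (intro exI[of _ c] exI[of _ d]) auto
    qed
    show "(\<integral>\<^sup>+\<tau>\<in>{a..b}. h \<tau> \<partial>lebesgue) \<le> ennreal r" using len(1) by (simp add: horizontal_length_def h_def)
  qed (use \<open>0 < r\<close> \<open>a \<le> b\<close> in auto)
  then show ?thesis using at_0[OF \<open>j \<le> k\<close> fiber(2)] \<open>j \<le> k\<close> by (simp add: Suc_diff_le)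
qed

lemma cc_dist_lessE:
  assumes "cc_dist k p q < ennreal r"
  obtains a b \<gamma> where "horizontal_curve k a b \<gamma>" "\<gamma> a = p" "\<gamma> b = q" "horizontal_length k a b \<gamma> \<le> ennreal r"
  using assms unfolding cc_dist_def INF_less_iff by (auto intro: less_imp_le)

text \<open>Removes the slack that comes from the infimum in the definition of the distance.\<close>

lemma le_power_if_all_greater:
  fixes x r :: real
  assumes "\<And>r'. r < r' \<Longrightarrow> x \<le> r' ^ n"
  shows "x \<le> r ^ n"
proof (rule tendsto_lowerbound)
  show "((\<lambda>r'. r' ^ n) \<longlongrightarrow> r ^ n) (at_right r)" by (intro tendsto_intros)
  show "eventually (\<lambda>r'. x \<le> r' ^ n) (at_right r)"
    using assms by (auto simp: eventually_at_right_field intro: exI[of _ "r + 1"])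
qed simp

lemma fst_diff_le_cc_dist:
  assumes "cc_dist k p q \<le> ennreal r" "0 \<le> r"
  shows "\<bar>fst p - fst q\<bar> \<le> r"
proof -
  have "\<bar>fst p - fst q\<bar> \<le> r' ^ 1" if "r < r'" for r'
  proof -
    have "cc_dist k p q < ennreal r'" using assms that by (metis ennreal_lessI le_less_trans order.strict_trans1 not_le)
    then obtain a b \<gamma> where \<gamma>: "horizontal_curve k a b \<gamma>" "\<gamma> a = p" "\<gamma> b = q" "horizontal_length k a b \<gamma> \<le> ennreal r'"
      by (rule cc_dist_lessE)
    then have "b \<in> {a..b}" by (simp add: horizontal_curve_def)
    then show ?thesis using horizontal_curve_fst_le[OF \<gamma>(1,4)] \<gamma> that assms(2) by (fastforce simp: abs_minus_commute)
  qed
  then show ?thesis using le_power_if_all_greater[of r _ 1] by simp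
qed

lemma fiber_diff_le_cc_dist:
  assumes "cc_dist k p q \<le> ennreal r" "0 \<le> r" "fst p = 0" "fst q = 0" "j \<le> k"
  shows "\<bar>snd p j - snd q j\<bar> \<le> r ^ (k + 1 - j)"
proof (rule le_power_if_all_greater)
  fix r' assume "r < r'"
  then have "cc_dist k p q < ennreal r'" using assms by (metis ennreal_lessI le_less_trans order.strict_trans1 not_le)
  then obtain a b \<gamma> where \<gamma>: "horizontal_curve k a b \<gamma>" "\<gamma> a = p" "\<gamma> b = q" "horizontal_length k a b \<gamma> \<le> ennreal r'"
    by (rule cc_dist_lessE)
  then show "\<bar>snd p j - snd q j\<bar> \<le> r' ^ (k + 1 - j)"
    using horizontal_curve_fiber_le[OF \<gamma>(1,4)] assms \<open>r < r'\<close> by (simp add: abs_minus_commute)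
qed


section \<open>Upper bounds for the Carnot-Caratheodory distance\<close>

lemma smooth_has_derivative:
  assumes "smooth f"
  shows "((deriv ^^ n) f has_real_derivative (deriv ^^ Suc n) f x) (at x)"
  using assms by (simp add: smooth_def DERIV_deriv_iff_real_differentiable)

lemma smooth_continuous:
  assumes "smooth f"
  shows "continuous_on S ((deriv ^^ n) f)"
  by (intro continuous_at_imp_continuous_on ballI DERIV_isCont[OF smooth_has_derivative[OF assms]])

lemma lipschitz_on_segment:
  fixes f :: "real \<Rightarrow> real"
  assumes D: "\<And>x. (f has_real_derivative f' x) (at x)" and cont: "continuous_on {a..b} f'"
  obtains K where "\<And>x y. x \<in> {a..b} \<Longrightarrow> y \<in> {a..b} \<Longrightarrow> \<bar>f x - f y\<bar> \<le> K * \<bar>x - y\<bar>"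
proof -
  have "compact (f' ` {a..b})" using cont by (rule compact_continuous_image) simp
  then obtain K where K: "\<And>x. x \<in> {a..b} \<Longrightarrow> norm (f' x) \<le> K"
    using compact_imp_bounded bounded_iff by (metis imageI)
  have "norm (f x - f y) \<le> K * norm (x - y)" if "x \<in> {a..b}" "y \<in> {a..b}" for x y
    using that K by (intro field_differentiable_bound[of "{a..b}" f f']) (auto intro: has_field_derivative_at_within D)
  then show ?thesis using that by auto
qed

text \<open>The two halves of the broken jet curve below meet at the parameter \<open>0\<close>.\<close>

lemma abs_continuous_on_interval_glue:
  fixes f g :: "real \<Rightarrow> real"
  assumes f: "\<And>x. (f has_real_derivative f' x) (at x)" "continuous_on {-1..0} f'"
    and g: "\<And>x. (g has_real_derivative g' x) (at x)" "continuous_on {0..1} g'" and "f 0 = g 0"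
  shows "abs_continuous_on_interval (-1) 1 (\<lambda>x. if x \<le> 0 then f x else g x)"
proof -
  define w where "w x = (if x \<le> 0 then f x else g x)" for x
  obtain K1 where K1: "\<And>x y. x \<in> {-1..0} \<Longrightarrow> y \<in> {-1..0} \<Longrightarrow> \<bar>f x - f y\<bar> \<le> K1 * \<bar>x - y\<bar>"
    using lipschitz_on_segment[OF f] by blast
  obtain K2 where K2: "\<And>x y. x \<in> {0..1} \<Longrightarrow> y \<in> {0..1} \<Longrightarrow> \<bar>g x - g y\<bar> \<le> K2 * \<bar>x - y\<bar>"
    using lipschitz_on_segment[OF g] by blast
  have wf: "w x = f x" if "x \<le> 0" for x using that by (simp add: w_def)
  have wg: "w x = g x" if "0 \<le> x" for x using that \<open>f 0 = g 0\<close> by (cases "x = 0") (simp_all add: w_def)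
  have K1_le: "K1 * x \<le> (\<bar>K1\<bar> + \<bar>K2\<bar>) * x" and K2_le: "K2 * x \<le> (\<bar>K1\<bar> + \<bar>K2\<bar>) * x" if "0 \<le> x" for x
    using that by (auto intro!: mult_right_mono)
  have "abs_continuous_on_interval (-1) 1 w"
  proof (rule lipschitz_imp_abs_continuous_on_interval[where K = "\<bar>K1\<bar> + \<bar>K2\<bar>"])
    fix c d :: real assume cd: "-1 \<le> c" "c \<le> d" "d \<le> 1"
    consider "d \<le> 0" | "0 \<le> c" | "c \<le> 0" "0 \<le> d" by linarith
    then show "\<bar>w d - w c\<bar> \<le> (\<bar>K1\<bar> + \<bar>K2\<bar>) * (d - c)"
    proof cases
      case 1
      then have "\<bar>w d - w c\<bar> \<le> K1 * (d - c)" using K1[of d c] cd by (simp add: wf)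
      then show ?thesis using K1_le[of "d - c"] cd by simp
    next
      case 2
      then have "\<bar>w d - w c\<bar> \<le> K2 * (d - c)" using K2[of d c] cd by (simp add: wg)
      then show ?thesis using K2_le[of "d - c"] cd by simp
    next
      case 3
      then have "\<bar>w d - w 0\<bar> \<le> K2 * d" using K2[of d 0] cd by (simp add: wg)
      moreover have "\<bar>w 0 - w c\<bar> \<le> K1 * (- c)" using 3 K1[of 0 c] cd by (simp add: wf)
      ultimately have "\<bar>w d - w c\<bar> \<le> (\<bar>K1\<bar> + \<bar>K2\<bar>) * d + (\<bar>K1\<bar> + \<bar>K2\<bar>) * (- c)"
        using K2_le[of d] K1_le[of "- c"] 3 by linarith
      then show ?thesis by (simp add: algebra_simps)
    qed
  qed
  then show ?thesis by (simp add: w_def[abs_def])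
qed

lemma jet_in_jet_space: "jet k f x \<in> jet_space k"
  by (simp add: jet_def jet_space_def)

lemma jet_has_jet_derivative:
  assumes "smooth f"
  shows "has_jet_derivative (\<lambda>\<tau>. jet k f (c + \<tau> * e))
    (horizontal_vector k (jet k f (c + \<tau> * e)) e (e * (deriv ^^ Suc k) f (c + \<tau> * e))) \<tau>"
proof -
  have D: "((\<lambda>\<tau>. (deriv ^^ j) f (c + \<tau> * e)) has_real_derivative (deriv ^^ Suc j) f (c + \<tau> * e) * e) (at \<tau>)" for j
    by (rule DERIV_chain'[OF _ smooth_has_derivative[OF assms]]) (auto intro!: derivative_eq_intros)
  have "((\<lambda>\<tau>. snd (jet k f (c + \<tau> * e)) j) has_real_derivative
      snd (horizontal_vector k (jet k f (c + \<tau> * e)) e (e * (deriv ^^ Suc k) f (c + \<tau> * e))) j) (at \<tau>)" for j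
    using D[of j] by (cases j k rule: linorder_cases) (simp_all add: jet_def horizontal_vector_def jet_X_def jet_U_def mult.commute)
  moreover have "((\<lambda>\<tau>. fst (jet k f (c + \<tau> * e))) has_real_derivative e) (at \<tau>)"
    by (auto simp: jet_def intro!: derivative_eq_intros)
  ultimately show ?thesis by (simp add: has_jet_derivative_def horizontal_vector_components)
qed

lemma has_jet_derivative_cong_open:
  assumes "has_jet_derivative \<gamma> v \<tau>" "open S" "\<tau> \<in> S" "\<And>s. s \<in> S \<Longrightarrow> \<gamma> s = \<gamma>' s"
  shows "has_jet_derivative \<gamma>' v \<tau>"
  using assms unfolding has_jet_derivative_def
  by (auto intro: has_field_derivative_transform_within_open[where S = S])

text \<open>The curve follows the jet of \<open>F\<close> from \<open>a\<close> to \<open>c\<close>, then that of \<open>G\<close> from \<open>c\<close> to \<open>b\<close>; on jets of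
  smooth functions the velocity is horizontal, with \<open>u\<^sub>k\<close>-component given by the derivative of order
  \<open>k + 1\<close>. The case \<open>F = G\<close>, \<open>c = b\<close> says that jet curves are locally Lipschitz; the case \<open>a = b\<close> moves
  inside a fiber. The factor \<open>2\<close> is the length of the parameter interval \<open>{-1..1}\<close>.\<close>

lemma cc_dist_broken_jet_le:
  assumes F: "smooth F" and G: "smooth G" and eq: "jet k F c = jet k G c"
    and DF: "\<And>x. x \<in> closed_segment a c \<Longrightarrow> \<bar>(deriv ^^ Suc k) F x\<bar> \<le> D"
    and DG: "\<And>x. x \<in> closed_segment c b \<Longrightarrow> \<bar>(deriv ^^ Suc k) G x\<bar> \<le> D"
  shows "cc_dist k (jet k F a) (jet k G b) \<le> ennreal (2 * (1 + D) * (\<bar>c - a\<bar> + \<bar>b - c\<bar>))"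
proof -
  define \<gamma> where "\<gamma> \<tau> = (if \<tau> \<le> 0 then jet k F (c + \<tau> * (c - a)) else jet k G (c + \<tau> * (b - c)))" for \<tau> :: real
  define B where "B = (1 + D) * (\<bar>c - a\<bar> + \<bar>b - c\<bar>)"
  have "0 \<le> D" using DF[of a] by (meson abs_ge_zero ends_in_segment(1) order_trans)
  then have "0 \<le> B" by (simp add: B_def)
  have deriv1: "has_jet_derivative \<gamma> (horizontal_vector k (\<gamma> \<tau>) (c - a) ((c - a) * (deriv ^^ Suc k) F (c + \<tau> * (c - a)))) \<tau>" if "\<tau> < 0" for \<tau>
    using jet_has_jet_derivative[OF F, of k c "c - a" \<tau>] that
    by (intro has_jet_derivative_cong_open[where S = "{..<0}" and \<gamma>' = \<gamma>]) (auto simp: \<gamma>_def)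
  have deriv2: "has_jet_derivative \<gamma> (horizontal_vector k (\<gamma> \<tau>) (b - c) ((b - c) * (deriv ^^ Suc k) G (c + \<tau> * (b - c)))) \<tau>" if "0 < \<tau>" for \<tau>
    using jet_has_jet_derivative[OF G, of k c "b - c" \<tau>] that
    by (intro has_jet_derivative_cong_open[where S = "{0<..}" and \<gamma>' = \<gamma>]) (auto simp: \<gamma>_def)
  have AE0: "AE \<tau> in lebesgue. \<tau> \<noteq> (0 :: real)" by (intro AE_completion AE_lborel_singleton)
  have jet0: "snd (jet k F c) j = snd (jet k G c) j" for j using eq by simp
  have chain: "((\<lambda>\<tau>. (deriv ^^ j) f (c + \<tau> * e)) has_real_derivative (deriv ^^ Suc j) f (c + \<tau> * e) * e) (at \<tau>)" if "smooth f" for f j e \<tau>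
    by (rule DERIV_chain'[OF _ smooth_has_derivative[OF that]]) (auto intro!: derivative_eq_intros)
  have cont: "continuous_on S (\<lambda>\<tau>. (deriv ^^ j) f (c + \<tau> * e) * e)" if "smooth f" for f j e S
    by (intro continuous_intros continuous_on_compose2[OF smooth_continuous[OF that, of UNIV]]) auto
  have "horizontal_curve k (-1) 1 \<gamma>"
    unfolding horizontal_curve_def
  proof (intro conjI allI impI)
    show "\<gamma> ` {-1..1} \<subseteq> jet_space k" by (auto simp: \<gamma>_def jet_in_jet_space)
    have "abs_continuous_on_interval (-1) 1 (\<lambda>\<tau>. if \<tau> \<le> 0 then c + \<tau> * (c - a) else c + \<tau> * (b - c))"
      by (rule abs_continuous_on_interval_glue[where f' = "\<lambda>_. c - a" and g' = "\<lambda>_. b - c"])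
         (auto intro!: derivative_eq_intros)
    moreover have "(\<lambda>\<tau>. fst (\<gamma> \<tau>)) = (\<lambda>\<tau>. if \<tau> \<le> 0 then c + \<tau> * (c - a) else c + \<tau> * (b - c))"
      by (auto simp: \<gamma>_def jet_def)
    ultimately show "abs_continuous_on_interval (-1) 1 (\<lambda>\<tau>. fst (\<gamma> \<tau>))" by simp
    fix j assume "j \<le> k"
    have "abs_continuous_on_interval (-1) 1 (\<lambda>\<tau>. if \<tau> \<le> 0 then (deriv ^^ j) F (c + \<tau> * (c - a)) else (deriv ^^ j) G (c + \<tau> * (b - c)))"
      by (rule abs_continuous_on_interval_glue[OF chain[OF F] cont[OF F] chain[OF G] cont[OF G]])
         (use jet0[of j] \<open>j \<le> k\<close> in \<open>simp add: jet_def\<close>)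
    moreover have "(\<lambda>\<tau>. snd (\<gamma> \<tau>) j) = (\<lambda>\<tau>. if \<tau> \<le> 0 then (deriv ^^ j) F (c + \<tau> * (c - a)) else (deriv ^^ j) G (c + \<tau> * (b - c)))"
      using \<open>j \<le> k\<close> by (auto simp: \<gamma>_def jet_def)
    ultimately show "abs_continuous_on_interval (-1) 1 (\<lambda>\<tau>. snd (\<gamma> \<tau>) j)" by simp
  next
    show "AE \<tau> in lebesgue. \<tau> \<in> {-1..1} \<longrightarrow> (\<exists>v \<in> horizontal_space k (\<gamma> \<tau>). has_jet_derivative \<gamma> v \<tau>)"
    proof (rule AE_mp[OF AE0], intro AE_I2 impI)
      fix \<tau> :: real assume "\<tau> \<noteq> 0"
      then show "\<exists>v \<in> horizontal_space k (\<gamma> \<tau>). has_jet_derivative \<gamma> v \<tau>"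
        using deriv1[of \<tau>] deriv2[of \<tau>] unfolding horizontal_space_def by (metis (mono_tags, lifting) linorder_neqE_linordered_idom mem_Collect_eq)
    qed
  qed simp
  moreover have "\<gamma> (-1) = jet k F a" "\<gamma> 1 = jet k G b" by (simp_all add: \<gamma>_def)
  ultimately have "cc_dist k (jet k F a) (jet k G b) \<le> horizontal_length k (-1) 1 \<gamma>"
    unfolding cc_dist_def by (intro INF_lower2[of "(-1, 1, \<gamma>)"]) auto
  also have "\<dots> \<le> (\<integral>\<^sup>+\<tau>. ennreal B * indicator {-1..1 :: real} \<tau> \<partial>lebesgue)"
    unfolding horizontal_length_def
  proof (rule nn_integral_mono_AE, use AE0 in eventually_elim)
    fix \<tau> :: real assume "\<tau> \<noteq> 0"
    have speed: "sqrt (e\<^sup>2 + (e * y)\<^sup>2) \<le> B" if "\<bar>y\<bar> \<le> D" "\<bar>e\<bar> \<le> \<bar>c - a\<bar> + \<bar>b - c\<bar>" for e y :: real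
    proof -
      have "sqrt (e\<^sup>2 + (e * y)\<^sup>2) \<le> \<bar>e\<bar> + \<bar>e * y\<bar>" by (rule sqrt_sum_squares_le_sum_abs)
      also have "\<dots> = (1 + \<bar>y\<bar>) * \<bar>e\<bar>" by (simp add: abs_mult algebra_simps)
      also have "\<dots> \<le> B" unfolding B_def using that \<open>0 \<le> D\<close> by (intro mult_mono) auto
      finally show ?thesis .
    qed
    have "sqrt ((deriv (\<lambda>s. fst (\<gamma> s)) \<tau>)\<^sup>2 + (deriv (\<lambda>s. snd (\<gamma> s) k) \<tau>)\<^sup>2) \<le> B" if \<tau>: "\<tau> \<in> {-1..1}"
    proof (cases "\<tau> < 0")
      case True
      define y where "y = (deriv ^^ Suc k) F (c + \<tau> * (c - a))"
      have "deriv (\<lambda>s. fst (\<gamma> s)) \<tau> = c - a" "deriv (\<lambda>s. snd (\<gamma> s) k) \<tau> = (c - a) * y"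
        using deriv1[OF True] unfolding has_jet_derivative_def y_def
        by (metis DERIV_imp_deriv horizontal_vector_components)+
      moreover have "\<bar>y\<bar> \<le> D" unfolding y_def
      proof (rule DF)
        have "c + \<tau> * (c - a) = (1 - (- \<tau>)) *\<^sub>R c + (- \<tau>) *\<^sub>R a" by (simp add: algebra_simps)
        then have "c + \<tau> * (c - a) \<in> closed_segment c a" using True \<tau> unfolding in_segment by (intro exI[of _ "- \<tau>"]) auto
        then show "c + \<tau> * (c - a) \<in> closed_segment a c" by (simp add: closed_segment_commute)
      qed
      ultimately show ?thesis using speed[of y "c - a"] by simp
    next
      case False
      then have "0 < \<tau>" using \<open>\<tau> \<noteq> 0\<close> by simp
      define y where "y = (deriv ^^ Suc k) G (c + \<tau> * (b - c))"
      have "deriv (\<lambda>s. fst (\<gamma> s)) \<tau> = b - c" "deriv (\<lambda>s. snd (\<gamma> s) k) \<tau> = (b - c) * y"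
        using deriv2[OF \<open>0 < \<tau>\<close>] unfolding has_jet_derivative_def y_def
        by (metis DERIV_imp_deriv horizontal_vector_components)+
      moreover have "\<bar>y\<bar> \<le> D" unfolding y_def
      proof (rule DG)
        have "c + \<tau> * (b - c) = (1 - \<tau>) *\<^sub>R c + \<tau> *\<^sub>R b" by (simp add: algebra_simps)
        then show "c + \<tau> * (b - c) \<in> closed_segment c b" using \<open>0 < \<tau>\<close> \<tau> unfolding in_segment by (intro exI[of _ \<tau>]) auto
      qed
      ultimately show ?thesis using speed[of y "b - c"] by simp
    qed
    then show "ennreal (sqrt ((deriv (\<lambda>s. fst (\<gamma> s)) \<tau>)\<^sup>2 + (deriv (\<lambda>s. snd (\<gamma> s) k) \<tau>)\<^sup>2)) * indicator {-1..1} \<tau>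
        \<le> ennreal B * indicator {-1..1} \<tau>"
      by (auto simp: indicator_def intro!: ennreal_leI)
  qed
  also have "\<dots> = ennreal B * ennreal 2" by (subst nn_integral_cmult_indicator) auto
  also have "\<dots> = ennreal (B * 2)" using \<open>0 \<le> B\<close> by (subst ennreal_mult) auto
  also have "B * 2 = 2 * (1 + D) * (\<bar>c - a\<bar> + \<bar>b - c\<bar>)" by (simp add: B_def)
  finally show ?thesis .
qed

lemma higher_deriv_poly: "(deriv ^^ n) (poly p) = poly ((pderiv ^^ n) p)" for p :: "real poly"
  by (induction n) (auto intro!: DERIV_imp_deriv poly_DERIV)

lemma smooth_poly: "smooth (poly p)" for p :: "real poly"
  by (simp add: smooth_def higher_deriv_poly)

lemma poly_higher_pderiv_eq_0:
  fixes p :: "real poly"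
  assumes "[:- x, 1:] ^ Suc n dvd p" "j \<le> n"
  shows "poly ((pderiv ^^ j) p) x = 0"
proof -
  have step: "[:- x, 1:] ^ m dvd pderiv p" if "[:- x, 1:] ^ Suc m dvd p" for m and p :: "real poly"
  proof -
    define L where "L = [:- x, 1:]"
    have L: "pderiv L = 1" by (simp add: L_def pderiv_pCons)
    from that obtain q where p: "p = L ^ Suc m * q" unfolding L_def by (elim dvdE)
    have "pderiv p = L ^ m * (L * pderiv q + smult (1 + of_nat m) q)"
      unfolding p pderiv_mult pderiv_power_Suc L by (simp add: algebra_simps)
    then have "L ^ m dvd pderiv p" by simp
    then show ?thesis by (simp add: L_def)
  qed
  have "[:- x, 1:] ^ Suc (n - j) dvd (pderiv ^^ j) p"
    using assms(2)
  proof (induction j)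
    case (Suc j)
    then have "[:- x, 1:] ^ Suc (Suc (n - Suc j)) dvd (pderiv ^^ j) p" by (simp add: Suc_diff_Suc)
    then show ?case using step by (metis funpow.simps(2) o_apply)
  qed (use assms in simp)
  then have "[:- x, 1:] dvd (pderiv ^^ j) p" using dvd_trans dvd_power by (metis dvd_triv_left power_Suc)
  then show ?thesis by (simp add: poly_eq_0_iff_dvd)
qed

lemma higher_pderiv_pcompose_scale:
  fixes p :: "real poly"
  shows "(pderiv ^^ n) (pcompose p [:0, c:]) = smult (c ^ n) (pcompose ((pderiv ^^ n) p) [:0, c:])"
  by (induction n) (auto simp: pderiv_smult pderiv_pcompose pderiv_pCons mult.commute)

text \<open>With \<open>y = x ^ n\<close>, the polynomial \<open>1 - (1 - y) ^ n\<close> is divisible by \<open>y\<close>, and its complement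
  \<open>(1 - y) ^ n\<close> is divisible by \<open>(1 - x) ^ n\<close>. Multiplication by it kills jets of
  order below \<open>n\<close> at \<open>0\<close> and preserves them at \<open>1\<close>.\<close>

lemma transition_poly_exists:
  fixes n :: nat
  obtains \<eta> :: "real poly" where "[:0, 1:] ^ n dvd \<eta>" "[:- 1, 1:] ^ n dvd 1 - \<eta>"
proof (cases "n = 0")
  case False
  define y :: "real poly" where "y = [:0, 1:] ^ n"
  show ?thesis
  proof (rule that[of "1 - (1 - y) ^ n"])
    have "(1 - y) ^ n - 1 = (1 - y - 1) * (\<Sum>i<n. (1 - y) ^ i)" by (rule power_diff_1_eq)
    then have "1 - (1 - y) ^ n = y * (\<Sum>i<n. (1 - y) ^ i)" by (simp add: algebra_simps)
    then have "y dvd 1 - (1 - y) ^ n" by simp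
    then show "[:0, 1:] ^ n dvd 1 - (1 - y) ^ n" by (simp add: y_def)
    have "[:- 1, 1:] dvd 1 - y" by (simp add: y_def poly_eq_0_iff_dvd[symmetric])
    then show "[:- 1, 1:] ^ n dvd 1 - (1 - (1 - y) ^ n)" by (simp add: dvd_power_same)
  qed
qed (use that in simp)


lemma jet_poly: "jet k (poly p) x = (x, \<lambda>j. if j \<le> k then poly ((pderiv ^^ j) p) x else 0)" for p :: "real poly"
  by (auto simp: jet_def higher_deriv_poly fun_eq_iff)

lemma coeff_sum_monom: "coeff (\<Sum>j\<le>k. monom (c j) j) i = (if i \<le> k then c i else 0)"
  by (simp add: coeff_sum)

lemma poly_higher_pderiv_at_0: "poly ((pderiv ^^ j) p) 0 = fact j * coeff p j" for p :: "real poly"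
  by (simp add: poly_0_coeff_0 coeff_higher_pderiv pochhammer_fact)

lemma higher_pderiv_sum_monom_eq_0: "(pderiv ^^ Suc k) (\<Sum>j\<le>k. monom (c j) j) = 0" for c :: "nat \<Rightarrow> real"
  by (rule poly_eqI) (simp only: coeff_higher_pderiv coeff_sum_monom, simp)

text \<open>Let \<open>T\<close> be the Taylor polynomial with jet \<open>u\<close> at \<open>0\<close> and let \<open>q (x / r)\<close> be the one with jet
  \<open>v - u\<close>. Then \<open>G = T + q (x / r)\<close> has jet \<open>v\<close> at \<open>0\<close>, and for a transition polynomial \<open>\<eta>\<close> the
  polynomial \<open>F = T + (\<eta> * q) (x / r)\<close> has jet \<open>u\<close> at \<open>0\<close> and the jet of \<open>G\<close> at \<open>r\<close>. The hypothesis on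
  \<open>u - v\<close> says that the coefficients of \<open>q\<close> are at most \<open>r ^ (k + 1)\<close>, which is what the rescaling
  costs in the derivative of order \<open>k + 1\<close>; so that derivative of \<open>F\<close> is bounded independently of
  \<open>r\<close>, while that of \<open>G\<close> vanishes.\<close>

lemma cc_dist_fiber_le:
  "\<exists>K>0. \<forall>u v r. 0 < r \<longrightarrow> (0, u) \<in> jet_space k \<longrightarrow> (0, v) \<in> jet_space k \<longrightarrow>
     (\<forall>j\<le>k. \<bar>u j - v j\<bar> \<le> r ^ (k + 1 - j)) \<longrightarrow> cc_dist k (0, u) (0, v) \<le> ennreal (K * r)"
proof -
  obtain \<eta> :: "real poly" where \<eta>: "[:0, 1:] ^ Suc k dvd \<eta>" "[:- 1, 1:] ^ Suc k dvd 1 - \<eta>"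
    by (rule transition_poly_exists)
  define P where "P j = (pderiv ^^ Suc k) (\<eta> * monom 1 j)" for j
  have "\<exists>B. \<forall>x\<in>{0..1}. \<bar>poly (P j) x\<bar> \<le> B" for j
  proof -
    have "compact (poly (P j) ` {0..1})" by (intro compact_continuous_image continuous_intros compact_Icc)
    then show ?thesis by (auto dest!: compact_imp_bounded simp: bounded_iff)
  qed
  then obtain B where B: "\<And>j x. x \<in> {0..1} \<Longrightarrow> \<bar>poly (P j) x\<bar> \<le> B j" by metis
  have B_nonneg: "0 \<le> B j" for j using B[of 0 j] by (meson abs_ge_zero atLeastAtMost_iff order_refl order_trans zero_le_one)
  define D where "D = (\<Sum>j\<le>k. B j)"
  have "0 \<le> D" unfolding D_def by (intro sum_nonneg B_nonneg)
  show ?thesis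
  proof (intro exI[of _ "4 * (1 + D)"] conjI allI impI)
    show "4 * (1 + D) > 0" using \<open>0 \<le> D\<close> by simp
    fix u v :: "nat \<Rightarrow> real" and r :: real
    assume r: "0 < r" and uv: "(0, u) \<in> jet_space k" "(0, v) \<in> jet_space k"
      and "\<forall>j\<le>k. \<bar>u j - v j\<bar> \<le> r ^ (k + 1 - j)"
    then have close: "\<bar>u j - v j\<bar> \<le> r ^ (k + 1 - j)" if "j \<le> k" for j using that by blast
    define c where "c j = (v j - u j) * r ^ j / fact j" for j
    define q where "q = (\<Sum>j\<le>k. monom (c j) j)"
    define T where "T = (\<Sum>j\<le>k. monom (u j / fact j) j)"
    define F where "F = T + pcompose (\<eta> * q) [:0, 1 / r:]"
    define G where "G = T + pcompose q [:0, 1 / r:]"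
    have hF: "poly ((pderiv ^^ j) F) x = poly ((pderiv ^^ j) T) x + (1 / r) ^ j * poly ((pderiv ^^ j) (\<eta> * q)) (x / r)" for j x
      by (simp add: F_def higher_pderiv_add higher_pderiv_pcompose_scale poly_pcompose)
    have hG: "poly ((pderiv ^^ j) G) x = poly ((pderiv ^^ j) T) x + (1 / r) ^ j * poly ((pderiv ^^ j) q) (x / r)" for j x
      by (simp add: G_def higher_pderiv_add higher_pderiv_pcompose_scale poly_pcompose)
    have T0: "poly ((pderiv ^^ j) T) 0 = u j" if "j \<le> k" for j
      using that by (simp add: poly_higher_pderiv_at_0 T_def coeff_sum_monom)
    have "[:- 0, 1:] ^ Suc k dvd \<eta> * q" using \<eta>(1) by simp
    then have "poly ((pderiv ^^ j) F) 0 = u j" if "j \<le> k" for j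
      using that by (simp only: hF T0) (simp add: poly_higher_pderiv_eq_0 del: power_Suc)
    then have F0: "jet k (poly F) 0 = (0, u)" using uv by (auto simp: jet_poly jet_space_def)
    have "poly ((pderiv ^^ j) G) 0 = v j" if "j \<le> k" for j
    proof -
      have "poly ((pderiv ^^ j) q) 0 = fact j * c j" using that by (simp add: poly_higher_pderiv_at_0 q_def coeff_sum_monom)
      moreover have "(1 / r) ^ j * (fact j * c j) = v j - u j" using r by (simp add: c_def power_one_over)
      ultimately show ?thesis unfolding hG T0[OF that] by simp
    qed
    then have G0: "jet k (poly G) 0 = (0, v)" using uv by (auto simp: jet_poly jet_space_def)
    have "poly ((pderiv ^^ j) (\<eta> * q)) 1 = poly ((pderiv ^^ j) q) 1" if "j \<le> k" for j
    proof -
      have "[:- 1, 1:] ^ Suc k dvd (1 - \<eta>) * q" using \<eta>(2) by (rule dvd_mult2)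
      then have "poly ((pderiv ^^ j) ((1 - \<eta>) * q)) 1 = 0" using that by (rule poly_higher_pderiv_eq_0)
      moreover have "q = \<eta> * q + (1 - \<eta>) * q" by (simp add: algebra_simps)
      ultimately show ?thesis by (metis add.right_neutral higher_pderiv_add poly_add)
    qed
    then have match: "jet k (poly F) r = jet k (poly G) r" using r by (auto simp: jet_poly hF hG)
    have "(pderiv ^^ Suc k) T = 0" "(pderiv ^^ Suc k) q = 0"
      unfolding T_def q_def by (rule higher_pderiv_sum_monom_eq_0)+
    then have topG: "poly ((pderiv ^^ Suc k) G) x = 0"
      and topF: "poly ((pderiv ^^ Suc k) F) x = (1 / r) ^ Suc k * poly ((pderiv ^^ Suc k) (\<eta> * q)) (x / r)" for x
      unfolding hF hG by simp_all
    have c_le: "\<bar>c j\<bar> \<le> r ^ Suc k" if "j \<le> k" for j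
    proof -
      have "\<bar>c j\<bar> = \<bar>u j - v j\<bar> * r ^ j / fact j" using r by (simp add: c_def abs_mult abs_minus_commute)
      also have "\<dots> \<le> r ^ (k + 1 - j) * r ^ j / 1"
        using r by (intro frac_le mult_right_mono close[OF that]) auto
      also have "\<dots> = r ^ Suc k" using that by (simp add: power_add[symmetric] del: power_Suc)
      finally show ?thesis .
    qed
    have "\<eta> * q = (\<Sum>j\<le>k. smult (c j) (\<eta> * monom 1 j))"
      by (simp add: q_def sum_distrib_left mult_smult_right[symmetric] smult_monom)
    then have "(pderiv ^^ Suc k) (\<eta> * q) = (\<Sum>j\<le>k. smult (c j) (P j))"
      by (simp only: higher_pderiv_sum higher_pderiv_smult P_def)
    then have top_q: "poly ((pderiv ^^ Suc k) (\<eta> * q)) y = (\<Sum>j\<le>k. c j * poly (P j) y)" for y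
      by (simp only: poly_sum poly_smult)
    have topF_le: "\<bar>poly ((pderiv ^^ Suc k) F) x\<bar> \<le> D" if "x \<in> {0..r}" for x
    proof -
      have "x / r \<in> {0..1}" using that r by simp
      then have "\<bar>\<Sum>j\<le>k. c j * poly (P j) (x / r)\<bar> \<le> (\<Sum>j\<le>k. r ^ Suc k * B j)"
        by (intro order_trans[OF sum_abs] sum_mono) (simp only: abs_mult, intro mult_mono c_le B, auto simp: r less_imp_le)
      also have "\<dots> = r ^ Suc k * D" by (simp only: D_def sum_distrib_left)
      finally have "(1 / r) ^ Suc k * \<bar>poly ((pderiv ^^ Suc k) (\<eta> * q)) (x / r)\<bar> \<le> (1 / r) ^ Suc k * (r ^ Suc k * D)"
        unfolding top_q using r by (intro mult_left_mono) auto
      also have "\<dots> = D" using r by (simp add: power_one_over)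
      finally show ?thesis unfolding topF abs_mult using r by (simp del: power_Suc)
    qed
    have "cc_dist k (jet k (poly F) 0) (jet k (poly G) 0) \<le> ennreal (2 * (1 + D) * (\<bar>r - 0\<bar> + \<bar>0 - r\<bar>))"
    proof (rule cc_dist_broken_jet_le[OF smooth_poly smooth_poly match])
      show "\<bar>(deriv ^^ Suc k) (poly F) x\<bar> \<le> D" if "x \<in> closed_segment 0 r" for x
        unfolding higher_deriv_poly using that r by (intro topF_le) (simp add: closed_segment_eq_real_ivl)
      show "\<bar>(deriv ^^ Suc k) (poly G) x\<bar> \<le> D" for x
        unfolding higher_deriv_poly topG using \<open>0 \<le> D\<close> by simp
    qed
    then show "cc_dist k (0, u) (0, v) \<le> ennreal (4 * (1 + D) * r)"
      using r by (simp add: F0 G0 algebra_simps)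
  qed
qed


section \<open>Hausdorff measure and dimension\<close>

lemma hausdorff_premeasure_le:
  assumes "\<And>i. U i \<subseteq> X" "\<And>i. diam_wrt d (U i) \<le> ennreal \<delta>" "A \<subseteq> (\<Union>i. U i)"
  shows "hausdorff_premeasure X d s \<delta> A \<le> (\<Sum>i. diam_power d s (U i))"
  unfolding hausdorff_premeasure_def by (rule INF_lower) (use assms in auto)

lemma hausdorff_measure_eq_0_iff:
  "hausdorff_measure X d s A = 0 \<longleftrightarrow> (\<forall>\<delta>>0. hausdorff_premeasure X d s \<delta> A = 0)"
  unfolding hausdorff_measure_def by (auto simp: bot_ennreal[symmetric] SUP_bot_conv)

lemma hausdorff_premeasure_lessD:
  assumes "hausdorff_premeasure X d s \<delta> A < c"
  shows "\<exists>U. (\<forall>i. U i \<subseteq> X \<and> diam_wrt d (U i) \<le> ennreal \<delta>) \<and> A \<subseteq> (\<Union>i. U i) \<and>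
    (\<Sum>i. diam_power d s (U i)) < c"
  using assms unfolding hausdorff_premeasure_def INF_less_iff by blast

lemma hausdorff_measure_mono:
  assumes "A \<subseteq> B"
  shows "hausdorff_measure X d s A \<le> hausdorff_measure X d s B"
  unfolding hausdorff_measure_def hausdorff_premeasure_def
  by (intro SUP_mono' INF_superset_mono) (use assms in auto)

text \<open>Alternating two sequences of sets yields a cover of the union of what they cover.\<close>

lemma suminf_interleave_le:
  fixes f :: "nat \<Rightarrow> ennreal"
  shows "(\<Sum>n. f n) \<le> (\<Sum>i. f (2 * i)) + (\<Sum>i. f (2 * i + 1))"
proof -
  have "(\<Sum>n<2*m. f n) = (\<Sum>i<m. f (2 * i)) + (\<Sum>i<m. f (2 * i + 1))" for m
    by (induction m) (auto simp: algebra_simps)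
  then have "(\<Sum>n<2*m. f n) \<le> (\<Sum>i. f (2 * i)) + (\<Sum>i. f (2 * i + 1))" for m
    by (simp add: add_mono sum_le_suminf)
  moreover have "(\<Sum>n<m. f n) \<le> (\<Sum>n<2*m. f n)" for m
    by (rule sum_mono2) auto
  ultimately have "(\<Sum>n<m. f n) \<le> (\<Sum>i. f (2 * i)) + (\<Sum>i. f (2 * i + 1))" for m
    using order_trans by blast
  then show ?thesis by (intro suminf_le_const) auto
qed

lemma hausdorff_measure_Un_eq_0:
  assumes "hausdorff_measure X d s A = 0" "hausdorff_measure X d s B = 0"
  shows "hausdorff_measure X d s (A \<union> B) = 0"
  unfolding hausdorff_measure_eq_0_iff
proof (intro allI impI)
  fix \<delta> :: real assume "\<delta> > 0"
  have "hausdorff_premeasure X d s \<delta> (A \<union> B) \<le> ennreal \<epsilon> + ennreal \<epsilon>" if "\<epsilon> > 0" for \<epsilon> :: real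
  proof -
    have A0: "hausdorff_premeasure X d s \<delta> A < ennreal \<epsilon>" and B0: "hausdorff_premeasure X d s \<delta> B < ennreal \<epsilon>"
      using assms \<open>\<delta> > 0\<close> \<open>\<epsilon> > 0\<close> by (auto simp: hausdorff_measure_eq_0_iff)
    obtain U where U: "\<And>i. U i \<subseteq> X" "\<And>i. diam_wrt d (U i) \<le> ennreal \<delta>" "A \<subseteq> (\<Union>i. U i)"
      "(\<Sum>i. diam_power d s (U i)) < ennreal \<epsilon>"
      using hausdorff_premeasure_lessD[OF A0] by blast
    obtain V where V: "\<And>i. V i \<subseteq> X" "\<And>i. diam_wrt d (V i) \<le> ennreal \<delta>" "B \<subseteq> (\<Union>i. V i)"
      "(\<Sum>i. diam_power d s (V i)) < ennreal \<epsilon>"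
      using hausdorff_premeasure_lessD[OF B0] by blast
    define W where "W n = (if even n then U (n div 2) else V (n div 2))" for n
    have W: "W (2 * i) = U i" "W (2 * i + 1) = V i" for i by (auto simp: W_def)
    have "U i \<subseteq> (\<Union>i. W i)" "V i \<subseteq> (\<Union>i. W i)" for i
      using UN_upper[of "2 * i" UNIV W] UN_upper[of "2 * i + 1" UNIV W] unfolding W by auto
    then have "A \<union> B \<subseteq> (\<Union>i. W i)" using U(3) V(3) by (meson UN_least Un_least subset_trans)
    then have "hausdorff_premeasure X d s \<delta> (A \<union> B) \<le> (\<Sum>i. diam_power d s (W i))"
      by (intro hausdorff_premeasure_le) (use U V in \<open>auto simp: W_def\<close>)
    also have "\<dots> \<le> (\<Sum>i. diam_power d s (U i)) + (\<Sum>i. diam_power d s (V i))"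
      using suminf_interleave_le[of "\<lambda>n. diam_power d s (W n)"] unfolding W .
    also have "\<dots> \<le> ennreal \<epsilon> + ennreal \<epsilon>" using U(4) V(4) by (intro add_mono) auto
    finally show ?thesis .
  qed
  from this[of "e / 2" for e] have "hausdorff_premeasure X d s \<delta> (A \<union> B) \<le> 0 + ennreal e" if "e > 0" for e
    using that by (simp add: ennreal_plus[symmetric] del: ennreal_plus)
  then show "hausdorff_premeasure X d s \<delta> (A \<union> B) = 0"
    by (metis add_0 ennreal_le_epsilon le_zero_eq)
qed

text \<open>Vanishing of the measure is required for every exponent above \<open>s\<close>, not only for exponents
  arbitrarily close to it, so that unions can be treated exponent by exponent. Negative exponents are
  excluded because \<^const>\<open>hausdorff_dim\<close> ignores them.\<close>

definition has_hausdorff_dim :: "'a set \<Rightarrow> ('a \<Rightarrow> 'a \<Rightarrow> ennreal) \<Rightarrow> 'a set \<Rightarrow> real \<Rightarrow> bool" where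
  "has_hausdorff_dim X d A s \<longleftrightarrow> (\<forall>s'>s. hausdorff_measure X d s' A = 0) \<and>
     (\<forall>s'. 0 \<le> s' \<longrightarrow> s' < s \<longrightarrow> hausdorff_measure X d s' A \<noteq> 0)"

lemma hausdorff_dim_eqI:
  assumes "has_hausdorff_dim X d A s" "0 \<le> s"
  shows "hausdorff_dim X d A = ennreal s"
  unfolding hausdorff_dim_def
proof (rule antisym)
  show "(INF s\<in>{s. 0 \<le> s \<and> hausdorff_measure X d s A = 0}. ennreal s) \<le> ennreal s"
  proof (rule ennreal_le_epsilon)
    fix e :: real assume "0 < e"
    then have "hausdorff_measure X d (s + e) A = 0" using assms by (simp add: has_hausdorff_dim_def)
    then have "(INF s\<in>{s. 0 \<le> s \<and> hausdorff_measure X d s A = 0}. ennreal s) \<le> ennreal (s + e)"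
      using assms \<open>0 < e\<close> by (intro INF_lower) auto
    then show "(INF s\<in>{s. 0 \<le> s \<and> hausdorff_measure X d s A = 0}. ennreal s) \<le> ennreal s + ennreal e"
      using assms \<open>0 < e\<close> by simp
  qed
  show "ennreal s \<le> (INF s\<in>{s. 0 \<le> s \<and> hausdorff_measure X d s A = 0}. ennreal s)"
    using assms(1) by (intro INF_greatest ennreal_leI) (auto simp: has_hausdorff_dim_def not_less[symmetric])
qed

lemma has_hausdorff_dim_Un:
  assumes "has_hausdorff_dim X d A s" "has_hausdorff_dim X d B t" "s \<le> t"
  shows "has_hausdorff_dim X d (A \<union> B) t"
proof -
  have "hausdorff_measure X d s' B \<noteq> 0 \<Longrightarrow> hausdorff_measure X d s' (A \<union> B) \<noteq> 0" for s'
    using hausdorff_measure_mono[of B "A \<union> B" X d s'] by auto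
  then show ?thesis using assms by (auto simp: has_hausdorff_dim_def intro: hausdorff_measure_Un_eq_0)
qed

lemma diam_power_le:
  assumes "diam_wrt d U \<le> ennreal r" "0 < s" "0 \<le> r"
  shows "diam_power d s U \<le> ennreal (r powr s)"
proof -
  have "enn2real (diam_wrt d U) \<le> r"
    using assms by (intro enn2real_leI)
  then show ?thesis using assms by (auto simp: diam_power_def intro!: ennreal_leI powr_mono2)
qed

text \<open>At stage \<open>n\<close> the covering sum is at most \<open>M ^ n * (K * \<rho> ^ n) powr s\<close>, which tends to \<open>0\<close>
  geometrically.\<close>

lemma hausdorff_measure_eq_0I:
  assumes "0 < s" "0 < \<rho>" "\<rho> < 1" "0 \<le> K" "real M * \<rho> powr s < 1"
    and cover: "\<And>n. \<exists>\<U>. finite \<U> \<and> card \<U> \<le> M ^ n \<and> A \<subseteq> \<Union>\<U> \<and>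
      (\<forall>U\<in>\<U>. U \<subseteq> X \<and> diam_wrt d U \<le> ennreal (K * \<rho> ^ n))"
  shows "hausdorff_measure X d s A = 0"
  unfolding hausdorff_measure_eq_0_iff
proof (intro allI impI)
  fix \<delta> :: real assume "\<delta> > 0"
  define q where "q = real M * \<rho> powr s"
  have lim: "(\<lambda>n. K * \<rho> ^ n) \<longlonglongrightarrow> K * 0"
    using assms by (intro tendsto_intros LIMSEQ_power_zero) auto
  have lim2: "(\<lambda>n. K powr s * q ^ n) \<longlonglongrightarrow> K powr s * 0"
    using assms by (intro tendsto_intros LIMSEQ_power_zero) (auto simp: q_def)
  have "hausdorff_premeasure X d s \<delta> A \<le> 0 + ennreal \<epsilon>" if "\<epsilon> > 0" for \<epsilon> :: real
  proof -
    have "eventually (\<lambda>n. K * \<rho> ^ n < \<delta>) sequentially" "eventually (\<lambda>n. K powr s * q ^ n < \<epsilon>) sequentially"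
      using order_tendstoD(2)[OF lim] order_tendstoD(2)[OF lim2] \<open>\<delta> > 0\<close> \<open>\<epsilon> > 0\<close> by auto
    then have "eventually (\<lambda>n. K * \<rho> ^ n < \<delta> \<and> K powr s * q ^ n < \<epsilon>) sequentially"
      by (rule eventually_conj)
    then obtain n where n: "K * \<rho> ^ n < \<delta>" "K powr s * q ^ n < \<epsilon>"
      using eventually_happens'[OF sequentially_bot] by blast
    from cover[of n] obtain \<U> where "finite \<U> \<and> card \<U> \<le> M ^ n \<and> A \<subseteq> \<Union>\<U> \<and>
      (\<forall>U\<in>\<U>. U \<subseteq> X \<and> diam_wrt d U \<le> ennreal (K * \<rho> ^ n))" ..
    then have U: "finite \<U>" "card \<U> \<le> M ^ n" "A \<subseteq> \<Union>\<U>"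
      "\<And>U. U \<in> \<U> \<Longrightarrow> U \<subseteq> X \<and> diam_wrt d U \<le> ennreal (K * \<rho> ^ n)" by simp_all
    obtain f where f: "bij_betw f {..<card \<U>} \<U>"
      using ex_bij_betw_nat_finite[OF U(1)] by (auto simp: atLeast0LessThan)
    define V where "V i = (if i < card \<U> then f i else {})" for i
    have fU: "f i \<in> \<U>" if "i < card \<U>" for i using f that by (auto simp: bij_betw_def)
    have VU: "\<Union>\<U> \<subseteq> (\<Union>i. V i)"
    proof (rule Union_least)
      fix S assume "S \<in> \<U>"
      then obtain i where "i < card \<U>" "S = f i" using f by (auto simp: bij_betw_def)
      then have "S = V i" by (simp add: V_def)
      then show "S \<subseteq> (\<Union>i. V i)" by auto
    qed
    have "hausdorff_premeasure X d s \<delta> A \<le> (\<Sum>i. diam_power d s (V i))"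
    proof (rule hausdorff_premeasure_le)
      fix i
      show "V i \<subseteq> X" using U(4) fU by (auto simp: V_def)
      have "diam_wrt d (V i) \<le> ennreal (K * \<rho> ^ n)"
        using U(4)[OF fU, of i] by (auto simp: V_def diam_wrt_def bot_ennreal)
      also have "\<dots> \<le> ennreal \<delta>" using n by (intro ennreal_leI) auto
      finally show "diam_wrt d (V i) \<le> ennreal \<delta>" .
    qed (rule subset_trans[OF U(3) VU])
    also have "\<dots> = (\<Sum>i<card \<U>. diam_power d s (V i))"
      by (rule suminf_finite) (auto simp: V_def diam_power_def)
    also have "\<dots> \<le> (\<Sum>i<card \<U>. ennreal ((K * \<rho> ^ n) powr s))"
    proof (rule sum_mono)
      fix i assume "i \<in> {..<card \<U>}"
      then show "diam_power d s (V i) \<le> ennreal ((K * \<rho> ^ n) powr s)"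
        using U(4)[OF fU, of i] assms by (intro diam_power_le) (auto simp: V_def)
    qed
    also have "\<dots> = ennreal (real (card \<U>) * (K * \<rho> ^ n) powr s)"
      by (simp add: ennreal_mult ennreal_of_nat_eq_real_of_nat)
    also have "\<dots> \<le> ennreal (real (M ^ n) * (K * \<rho> ^ n) powr s)"
      using U(2) by (intro ennreal_leI mult_right_mono) (auto simp del: of_nat_power)
    also have "real (M ^ n) * (K * \<rho> ^ n) powr s = K powr s * q ^ n"
      using assms by (simp add: q_def powr_mult power_mult_distrib powr_powr powr_realpow[symmetric] mult.commute)
    also have "ennreal (K powr s * q ^ n) \<le> ennreal \<epsilon>" using n by (intro ennreal_leI) auto
    finally show ?thesis by simp
  qed
  then show "hausdorff_premeasure X d s \<delta> A = 0" by (metis add_0 ennreal_le_epsilon le_zero_eq)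
qed

text \<open>A mass distribution principle, formulated with a parametrisation \<open>\<psi>\<close> instead of a measure on the
  space: preimages of the sets of a cover need not be measurable, and are only required to lie in
  measurable sets of small measure. Covers by sets of diameter \<open>r \<le> 1\<close> suffice, and there
  \<open>r powr t\<close> is at most the contribution \<open>r powr s\<close> of the set, or \<open>1\<close> when \<open>s = 0\<close>.\<close>

lemma hausdorff_measure_neq_0I:
  assumes T: "T \<in> sets M" "emeasure M T \<noteq> 0" and s: "0 \<le> s" "s < t" and "0 < K"
    and A: "\<psi> ` T \<subseteq> A"
    and mass: "\<And>V r. V \<subseteq> T \<Longrightarrow> 0 \<le> r \<Longrightarrow> diam_wrt d (\<psi> ` V) \<le> ennreal r \<Longrightarrow>
      \<exists>B\<in>sets M. V \<subseteq> B \<and> emeasure M B \<le> ennreal (K * r powr t)"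
  shows "hausdorff_measure X d s A \<noteq> 0"
proof
  assume "hausdorff_measure X d s A = 0"
  then have "hausdorff_premeasure X d s 1 A = 0" by (simp add: hausdorff_measure_eq_0_iff)
  have "emeasure M T \<le> ennreal (K * \<epsilon>)" if "\<epsilon> > 0" for \<epsilon> :: real
  proof -
    have A0: "hausdorff_premeasure X d s 1 A < ennreal \<epsilon>"
      using \<open>hausdorff_premeasure X d s 1 A = 0\<close> that by simp
    obtain U where U: "\<And>i. U i \<subseteq> X" "\<And>i. diam_wrt d (U i) \<le> ennreal 1" "A \<subseteq> (\<Union>i. U i)"
      "(\<Sum>i. diam_power d s (U i)) < ennreal \<epsilon>"
      using hausdorff_premeasure_lessD[OF A0] by blast
    define V where "V i = {y \<in> T. \<psi> y \<in> U i}" for i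
    have "\<exists>B\<in>sets M. V i \<subseteq> B \<and> emeasure M B \<le> ennreal K * diam_power d s (U i)" for i
    proof (cases "V i = {}")
      case False
      define r where "r = enn2real (diam_wrt d (U i))"
      have dU: "diam_wrt d (U i) = ennreal r" and r: "0 \<le> r" "r \<le> 1"
        using U(2)[of i] by (auto simp: r_def ennreal_enn2real_if top_unique intro: enn2real_leI)
      have "diam_wrt d (\<psi> ` V i) \<le> diam_wrt d (U i)"
        unfolding diam_wrt_def by (rule SUP_subset_mono) (auto simp: V_def)
      then obtain B where B: "B \<in> sets M" "V i \<subseteq> B" "emeasure M B \<le> ennreal (K * r powr t)"
        using mass[of "V i" r] r dU by (auto simp: V_def)
      have "U i \<noteq> {}" using False by (auto simp: V_def)
      have "ennreal (r powr t) \<le> diam_power d s (U i)"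
      proof (cases "s = 0")
        case True
        have "r powr t \<le> 1 powr t" using r s by (intro powr_mono2) auto
        then show ?thesis using True \<open>U i \<noteq> {}\<close> by (simp add: diam_power_def)
      next
        case nonzero: False
        have "r powr t \<le> r powr s" using r s by (cases "r = 0") (auto intro!: powr_mono')
        then show ?thesis using nonzero \<open>U i \<noteq> {}\<close> by (simp add: diam_power_def r_def ennreal_leI)
      qed
      then have "ennreal K * ennreal (r powr t) \<le> ennreal K * diam_power d s (U i)"
        by (intro mult_left_mono) auto
      then show ?thesis using B \<open>0 < K\<close> by (auto simp: ennreal_mult intro: order_trans)
    qed (auto intro!: bexI[of _ "{}"])
    then obtain B where B: "\<And>i. B i \<in> sets M" "\<And>i. V i \<subseteq> B i"
      "\<And>i. emeasure M (B i) \<le> ennreal K * diam_power d s (U i)" by metis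
    have "T \<subseteq> (\<Union>i. B i)"
    proof
      fix y assume "y \<in> T"
      then have "\<psi> y \<in> (\<Union>i. U i)" using A U(3) by blast
      then show "y \<in> (\<Union>i. B i)" using B(2) \<open>y \<in> T\<close> by (auto simp: V_def)
    qed
    then have "emeasure M T \<le> emeasure M (\<Union>i. B i)" using B(1) by (intro emeasure_mono) auto
    also have "\<dots> \<le> (\<Sum>i. emeasure M (B i))" using B(1) by (intro emeasure_subadditive_countably) auto
    also have "\<dots> \<le> (\<Sum>i. ennreal K * diam_power d s (U i))" using B(3) by (intro suminf_le) auto
    also have "\<dots> = ennreal K * (\<Sum>i. diam_power d s (U i))" by (rule ennreal_suminf_cmult)
    also have "\<dots> \<le> ennreal K * ennreal \<epsilon>" using U(4) by (intro mult_left_mono) auto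
    finally show ?thesis using \<open>0 < K\<close> that by (simp add: ennreal_mult)
  qed
  from this[of "e / K" for e] have "emeasure M T \<le> 0 + ennreal e" if "e > 0" for e
    using that \<open>0 < K\<close> by simp
  then have "emeasure M T = 0" by (metis add_0 ennreal_le_epsilon le_zero_eq)
  then show False using T by simp
qed


section \<open>A staircase function\<close>

text \<open>The range of such a function is a Cantor-type set of dimension \<open>\<sigma>\<close>. The third clause is Hoelder
  continuity of the inverse, with exponent \<open>\<sigma>\<close>. The last one bounds the images of dyadic intervals of
  length \<open>2 powr - n\<close> by a multiple of \<open>2 powr - (n / \<sigma>)\<close>. The constant \<open>2\<close> suffices for all \<open>\<sigma>\<close>.\<close>

definition staircase :: "real \<Rightarrow> real \<Rightarrow> (real \<Rightarrow> real) \<Rightarrow> bool" where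
  "staircase \<sigma> C h \<longleftrightarrow> h 0 = 0 \<and> 0 < C \<and>
     (\<forall>y\<in>{0..<1}. \<forall>y'\<in>{0..<1}. \<bar>y - y'\<bar> \<le> 2 * \<bar>h y - h y'\<bar> powr \<sigma>) \<and>
     (\<forall>n. \<forall>a<2 ^ n. \<forall>y\<in>{real a / 2 ^ n..<(real a + 1) / 2 ^ n}. \<forall>y'\<in>{real a / 2 ^ n..<(real a + 1) / 2 ^ n}.
        \<bar>h y - h y'\<bar> \<le> C * (1 / 2) powr (real n / \<sigma>))"

lemma staircaseD:
  assumes "staircase \<sigma> C h"
  shows "h 0 = 0" "0 < C"
    "\<And>y y'. y \<in> {0..<1} \<Longrightarrow> y' \<in> {0..<1} \<Longrightarrow> \<bar>y - y'\<bar> \<le> 2 * \<bar>h y - h y'\<bar> powr \<sigma>"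
    "\<And>y y' n a. a < 2 ^ n \<Longrightarrow> y \<in> {real a / 2 ^ n..<(real a + 1) / 2 ^ n} \<Longrightarrow>
       y' \<in> {real a / 2 ^ n..<(real a + 1) / 2 ^ n} \<Longrightarrow> \<bar>h y - h y'\<bar> \<le> C * (1 / 2) powr (real n / \<sigma>)"
  using assms unfolding staircase_def by blast+

text \<open>For \<open>\<sigma> < 1\<close> put \<open>\<rho> = 2 powr - (1 / \<sigma>) < 1 / 2\<close> and \<open>h y = (\<Sum>i. \<rho> ^ i * \<lfloor>2 ^ i * y\<rfloor>)\<close>. All terms
  increase with \<open>y\<close>, and the \<open>n\<close>-th one jumps by at least \<open>\<rho> ^ n\<close> between points at distance at least
  \<open>2 ^ - n\<close>, which separates values. On a dyadic interval of level \<open>n\<close> the terms up to index \<open>n\<close> are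
  constant, and the others vary by at most \<open>\<rho> ^ i * 2 ^ (i - n)\<close>, a convergent geometric series. For
  \<open>\<sigma> = 1\<close> the series diverges, but the identity does the job.\<close>

lemma staircase_exists:
  fixes \<sigma> :: real
  assumes "0 < \<sigma>" "\<sigma> \<le> 1"
  shows "\<exists>h C. staircase \<sigma> C h"
proof (cases "\<sigma> = 1")
  case True
  have "staircase \<sigma> 1 (\<lambda>y. y)"
    unfolding staircase_def
  proof (intro conjI allI ballI impI)
    fix y y' :: real and n a :: nat
    assume "y \<in> {real a / 2 ^ n..<(real a + 1) / 2 ^ n}" "y' \<in> {real a / 2 ^ n..<(real a + 1) / 2 ^ n}"
    then have "\<bar>y - y'\<bar> \<le> (real a + 1) / 2 ^ n - real a / 2 ^ n" by auto
    also have "\<dots> = 1 / 2 ^ n" by (simp add: diff_divide_distrib[symmetric])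
    finally show "\<bar>y - y'\<bar> \<le> 1 * (1 / 2) powr (real n / \<sigma>)"
      using True by (simp add: powr_realpow power_one_over)
  qed (use True in auto)
  then show ?thesis by blast
next
  case False
  define \<rho> :: real where "\<rho> = (1 / 2) powr (1 / \<sigma>)"
  have "\<rho> < (1 / 2) powr 1" unfolding \<rho>_def using False assms by (intro powr_less_mono') (auto simp: field_simps)
  then have l: "0 < \<rho>" "2 * \<rho> < 1" by (auto simp: \<rho>_def)
  have lpow: "\<rho> ^ n = (1 / 2) powr (real n / \<sigma>)" for n
    by (simp add: \<rho>_def powr_realpow[symmetric] powr_powr)
  define h where "h y = (\<Sum>i. \<rho> ^ i * real_of_int \<lfloor>2 ^ i * y\<rfloor>)" for y :: real
  have term_le: "\<bar>\<rho> ^ i * real_of_int \<lfloor>2 ^ i * y\<rfloor>\<bar> \<le> (2 * \<rho>) ^ i" if "0 \<le> y" "y < 1" for y :: real and i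
  proof -
    have "real_of_int \<lfloor>2 ^ i * y\<rfloor> \<le> 2 ^ i * y" by linarith
    also have "\<dots> \<le> 2 ^ i * 1" using that by (intro mult_left_mono) auto
    finally have "real_of_int \<lfloor>2 ^ i * y\<rfloor> \<le> 2 ^ i" by simp
    then have "\<rho> ^ i * real_of_int \<lfloor>2 ^ i * y\<rfloor> \<le> \<rho> ^ i * 2 ^ i" using l by (intro mult_left_mono) auto
    moreover have "0 \<le> \<rho> ^ i * real_of_int \<lfloor>2 ^ i * y\<rfloor>" using l that by simp
    ultimately show ?thesis by (simp add: power_mult_distrib mult.commute)
  qed
  have summ: "summable (\<lambda>i. \<rho> ^ i * real_of_int \<lfloor>2 ^ i * y\<rfloor>)" if y01: "0 \<le> y" "y < 1" for y :: real
  proof (rule summable_comparison_test'[of "\<lambda>i. (2 * \<rho>) ^ i" 0])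
    show "summable (\<lambda>i. (2 * \<rho>) ^ i)" using l by (intro summable_geometric) auto
    show "norm (\<rho> ^ i * real_of_int \<lfloor>2 ^ i * y\<rfloor>) \<le> (2 * \<rho>) ^ i" for i
      using term_le[OF y01] by simp
  qed
  have h_diff: "h y' - h y = (\<Sum>i. \<rho> ^ i * (real_of_int \<lfloor>2 ^ i * y'\<rfloor> - real_of_int \<lfloor>2 ^ i * y\<rfloor>))"
    and sum_diff: "summable (\<lambda>i. \<rho> ^ i * (real_of_int \<lfloor>2 ^ i * y'\<rfloor> - real_of_int \<lfloor>2 ^ i * y\<rfloor>))"
    if "0 \<le> y" "y < 1" "0 \<le> y'" "y' < 1" for y y' :: real
    using suminf_diff[OF summ[OF that(3,4)] summ[OF that(1,2)]] summable_diff[OF summ[OF that(3,4)] summ[OF that(1,2)]]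
    by (simp_all add: h_def right_diff_distrib)
  have separated: "y' - y \<le> 2 * \<bar>h y' - h y\<bar> powr \<sigma>" if y: "0 \<le> y" "y < y'" "y' < 1" for y y' :: real
  proof -
    obtain m where m: "(1 / 2) ^ m < y' - y" using real_arch_pow_inv[of "y' - y" "1 / 2"] y by auto
    \<comment> \<open>The coarsest dyadic scale not exceeding the distance is at least half of the distance.\<close>
    define n where "n = (LEAST n. (1 / 2 :: real) ^ n \<le> y' - y)"
    have n: "(1 / 2 :: real) ^ n \<le> y' - y" unfolding n_def by (rule LeastI[of _ m]) (use m in auto)
    then obtain n' where n': "n = Suc n'" using y by (cases n) auto
    have "\<not> (1 / 2 :: real) ^ n' \<le> y' - y"
      using not_less_Least[of n' "\<lambda>n. (1 / 2 :: real) ^ n \<le> y' - y"] n' by (simp add: n_def[symmetric])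
    then have upper: "y' - y \<le> 2 * (1 / 2) ^ n" using n' by simp
    have "2 ^ n * (1 / 2 :: real) ^ n \<le> 2 ^ n * (y' - y)" using n by (intro mult_left_mono) auto
    then have "1 \<le> 2 ^ n * y' - 2 ^ n * y" by (simp add: right_diff_distrib power_one_over)
    then have "\<lfloor>2 ^ n * y + 1\<rfloor> \<le> \<lfloor>2 ^ n * y'\<rfloor>" by (intro floor_mono) simp
    then have "1 \<le> real_of_int \<lfloor>2 ^ n * y'\<rfloor> - real_of_int \<lfloor>2 ^ n * y\<rfloor>" by simp
    then have "\<rho> ^ n * 1 \<le> \<rho> ^ n * (real_of_int \<lfloor>2 ^ n * y'\<rfloor> - real_of_int \<lfloor>2 ^ n * y\<rfloor>)"
      using l by (intro mult_left_mono) auto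
    also have "\<dots> = (\<Sum>i\<in>{n}. \<rho> ^ i * (real_of_int \<lfloor>2 ^ i * y'\<rfloor> - real_of_int \<lfloor>2 ^ i * y\<rfloor>))" by simp
    also have "\<dots> \<le> h y' - h y"
      unfolding h_diff[OF y(1) less_trans[OF y(2,3)] order_trans[OF y(1) less_imp_le[OF y(2)]] y(3)]
    proof (rule sum_le_suminf)
      show "summable (\<lambda>i. \<rho> ^ i * (real_of_int \<lfloor>2 ^ i * y'\<rfloor> - real_of_int \<lfloor>2 ^ i * y\<rfloor>))"
        using y by (intro sum_diff) auto
      show "0 \<le> \<rho> ^ i * (real_of_int \<lfloor>2 ^ i * y'\<rfloor> - real_of_int \<lfloor>2 ^ i * y\<rfloor>)" for i
        using l y by (intro mult_nonneg_nonneg) (auto intro!: floor_mono mult_left_mono)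
    qed auto
    finally have "\<rho> ^ n \<le> h y' - h y" by simp
    then have "(\<rho> ^ n) powr \<sigma> \<le> \<bar>h y' - h y\<bar> powr \<sigma>" using l assms by (intro powr_mono2) auto
    also have "(\<rho> ^ n) powr \<sigma> = (1 / 2) ^ n" using assms by (simp add: lpow powr_powr powr_realpow)
    finally show ?thesis using upper by simp
  qed
  define C where "C = 1 / (1 - 2 * \<rho>)"
  have "staircase \<sigma> C h"
    unfolding staircase_def
  proof (intro conjI allI ballI impI)
    show "h 0 = 0" "C > 0" using l by (auto simp: h_def C_def)
    fix y y' :: real assume "y \<in> {0..<1}" "y' \<in> {0..<1}"
    then show "\<bar>y - y'\<bar> \<le> 2 * \<bar>h y - h y'\<bar> powr \<sigma>"
      using separated[of y y'] separated[of y' y] by (cases y y' rule: linorder_cases) (auto simp: abs_minus_commute)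
  next
    fix y y' :: real and n a :: nat
    assume a: "a < 2 ^ n" and y: "y \<in> {real a / 2 ^ n..<(real a + 1) / 2 ^ n}" "y' \<in> {real a / 2 ^ n..<(real a + 1) / 2 ^ n}"
    show "\<bar>h y - h y'\<bar> \<le> C * (1 / 2) powr (real n / \<sigma>)"
    proof -
      define d where "d i = \<rho> ^ i * (real_of_int \<lfloor>2 ^ i * y\<rfloor> - real_of_int \<lfloor>2 ^ i * y'\<rfloor>)" for i
      have "real a + 1 \<le> 2 ^ n" using a by (metis Suc_leI of_nat_Suc of_nat_le_iff of_nat_numeral of_nat_power add.commute)
      then have "(real a + 1) / 2 ^ n \<le> 1" by simp
      moreover have "0 \<le> real a / 2 ^ n" by simp
      ultimately have y01: "0 \<le> y" "y < 1" "0 \<le> y'" "y' < 1" using y unfolding atLeastLessThan_iff by linarith+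
      have floors: "int (2 ^ j * a) \<le> \<lfloor>2 ^ (j + n) * z\<rfloor>" "\<lfloor>2 ^ (j + n) * z\<rfloor> < int (2 ^ j * (a + 1))"
        if "z \<in> {real a / 2 ^ n..<(real a + 1) / 2 ^ n}" for z j
      proof -
        have z: "real a \<le> 2 ^ n * z" "2 ^ n * z < real a + 1" using that by (auto simp: field_simps)
        have "2 ^ j * real a \<le> 2 ^ j * (2 ^ n * z)" by (intro mult_left_mono z) auto
        moreover have "2 ^ j * (2 ^ n * z) < 2 ^ j * (real a + 1)" by (intro mult_strict_left_mono z) auto
        ultimately show "int (2 ^ j * a) \<le> \<lfloor>2 ^ (j + n) * z\<rfloor>" "\<lfloor>2 ^ (j + n) * z\<rfloor> < int (2 ^ j * (a + 1))"
          by (simp_all add: le_floor_iff floor_less_iff power_add mult.assoc distrib_left)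
      qed
      have d0: "d i = 0" if "i < n" for i
      proof -
        have "\<lfloor>2 ^ i * z\<rfloor> = int a div 2 ^ (n - i)" if "z \<in> {real a / 2 ^ n..<(real a + 1) / 2 ^ n}" for z
        proof -
          have "2 ^ i * z = 2 ^ n * z / real_of_int (2 ^ (n - i))"
            using \<open>i < n\<close> power_add[of "2 :: real" i "n - i"] by simp
          moreover have "\<lfloor>2 ^ n * z\<rfloor> = int a" using floors[OF that, of 0] by simp
          ultimately show ?thesis by (simp only: floor_divide_real_eq_div zero_le_power zero_le_numeral)
        qed
        then show ?thesis using y by (simp add: d_def)
      qed
      have "summable d" using sum_diff[OF y01(3,4,1,2)] by (simp add: d_def[abs_def])
      then have "(\<Sum>i. d i) = (\<Sum>i. d (i + n)) + (\<Sum>i<n. d i)" by (rule suminf_split_initial_segment)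
      then have "(\<Sum>i. d i) = (\<Sum>i. d (i + n))" using d0 by simp
      moreover have "h y - h y' = (\<Sum>i. d i)" using h_diff[OF y01(3,4,1,2)] by (simp add: d_def)
      moreover have "norm (\<Sum>i. d (i + n)) \<le> (\<Sum>i. \<rho> ^ n * (2 * \<rho>) ^ i)"
      proof (rule norm_suminf_le)
        fix i
        have "\<bar>\<lfloor>2 ^ (i + n) * y\<rfloor> - \<lfloor>2 ^ (i + n) * y'\<rfloor>\<bar> \<le> int (2 ^ i)"
          using floors[OF y(1), of i] floors[OF y(2), of i] by (simp add: algebra_simps)
        then have "\<bar>real_of_int \<lfloor>2 ^ (i + n) * y\<rfloor> - real_of_int \<lfloor>2 ^ (i + n) * y'\<rfloor>\<bar> \<le> real_of_int (int (2 ^ i))"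
          by (metis of_int_abs of_int_diff of_int_le_iff)
        then have "\<rho> ^ (i + n) * \<bar>real_of_int \<lfloor>2 ^ (i + n) * y\<rfloor> - real_of_int \<lfloor>2 ^ (i + n) * y'\<rfloor>\<bar> \<le> \<rho> ^ (i + n) * 2 ^ i"
          using l by (intro mult_left_mono) auto
        then show "norm (d (i + n)) \<le> \<rho> ^ n * (2 * \<rho>) ^ i"
          using l by (simp add: d_def abs_mult power_add power_mult_distrib mult_ac)
      qed (intro summable_mult summable_geometric, use l in simp)
      moreover have "(\<Sum>i. \<rho> ^ n * (2 * \<rho>) ^ i) = C * \<rho> ^ n"
        using l by (subst suminf_mult) (auto simp: suminf_geometric C_def intro!: summable_geometric)
      ultimately show ?thesis by (simp add: lpow)
    qed
  qed
  then show ?thesis by blast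
qed


section \<open>Sets of prescribed dimension\<close>

lemma diam_wrt_le:
  assumes "\<And>p q. p \<in> U \<Longrightarrow> q \<in> U \<Longrightarrow> d p q \<le> c"
  shows "diam_wrt d U \<le> c"
  unfolding diam_wrt_def using assms by (auto intro!: SUP_least)

lemma le_diam_wrt: "p \<in> U \<Longrightarrow> q \<in> U \<Longrightarrow> d p q \<le> diam_wrt d U"
  unfolding diam_wrt_def by (rule SUP_upper2[of "(p, q)"]) auto

lemma dyadic_interval:
  assumes "y \<in> {0..<1}"
  obtains a :: nat where "a < 2 ^ n" "y \<in> {real a / 2 ^ n..<(real a + 1) / 2 ^ n}"
proof (rule that[of "nat \<lfloor>2 ^ n * y\<rfloor>"])
  have "0 \<le> 2 ^ n * y" using assms by simp
  then have *: "real (nat \<lfloor>2 ^ n * y\<rfloor>) = real_of_int \<lfloor>2 ^ n * y\<rfloor>" by simp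
  show "y \<in> {real (nat \<lfloor>2 ^ n * y\<rfloor>) / 2 ^ n..<(real (nat \<lfloor>2 ^ n * y\<rfloor>) + 1) / 2 ^ n}"
    unfolding * by (simp add: divide_le_eq less_divide_eq mult.commute)
  have "real_of_int \<lfloor>2 ^ n * y\<rfloor> \<le> 2 ^ n * y" by (rule of_int_floor_le)
  also have "\<dots> < 2 ^ n" using assms by simp
  finally show "nat \<lfloor>2 ^ n * y\<rfloor> < 2 ^ n" using * by (metis of_nat_less_iff of_nat_numeral of_nat_power)
qed

lemma dyadic_interval_subset:
  assumes "a < 2 ^ n"
  shows "{real a / 2 ^ n..<(real a + 1) / 2 ^ n} \<subseteq> {0..<1}"
proof -
  have "real (Suc a) \<le> real (2 ^ n)" using assms by (intro of_nat_mono) simp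
  then have "(real a + 1) / 2 ^ n \<le> 1" by (simp add: divide_le_eq)
  moreover have "0 \<le> real a / 2 ^ n" by simp
  ultimately show ?thesis by (auto simp del: divide_le_eq_1_pos)
qed

text \<open>The hypothesis of \<open>hausdorff_measure_eq_0I\<close> for dyadic covers with \<open>2 ^ N\<close> pieces per stage.\<close>

lemma half_powr_sum_less_1:
  fixes s \<sigma> :: real
  assumes "0 < \<sigma>" "real N * \<sigma> < s"
  shows "real (2 ^ N) * ((1 / 2) powr (1 / \<sigma>)) powr s < 1"
proof -
  have "real N < s / \<sigma>" using assms by (simp add: field_simps)
  have "real (2 ^ N) * ((1 / 2) powr (1 / \<sigma>)) powr s = 2 powr (real N - s / \<sigma>)"
    by (simp add: powr_powr powr_diff powr_realpow powr_divide)
  also have "\<dots> < 2 powr 0" using \<open>real N < s / \<sigma>\<close> by (intro powr_less_mono) auto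
  finally show ?thesis by simp
qed

lemma jet_continuous_bound:
  assumes "smooth f"
  obtains D where "\<And>x. x \<in> {a..b} \<Longrightarrow> \<bar>(deriv ^^ n) f x\<bar> \<le> D"
proof -
  have "compact ((deriv ^^ n) f ` {a..b})"
    by (intro compact_continuous_image smooth_continuous assms) simp
  then obtain D where "\<And>y. y \<in> (deriv ^^ n) f ` {a..b} \<Longrightarrow> norm y \<le> D"
    using compact_imp_bounded bounded_iff by metis
  then show ?thesis by (intro that[of D]) auto
qed

text \<open>The map from \<open>x\<close> to the jet at \<open>x\<close> is locally bi-Lipschitz, so the dimension is the one of the range
  of \<open>h\<close> on the line.\<close>

lemma has_hausdorff_dim_jet_image:
  assumes \<sigma>: "0 < \<sigma>" and h: "staircase \<sigma> C h" and f: "smooth f"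
  shows "has_hausdorff_dim (jet_space k) (cc_dist k) ((\<lambda>y. jet k f (h y - c)) ` {0..<1}) \<sigma>"
proof -
  note expand = staircaseD(3)[OF h] and contract = staircaseD(4)[OF h]
  have "C > 0" using h by (rule staircaseD)
  define \<psi> where "\<psi> y = jet k f (h y - c)" for y
  define \<rho> :: real where "\<rho> = (1 / 2) powr (1 / \<sigma>)"
  have \<rho>: "0 < \<rho>" "\<rho> < 1"
    using powr_less_mono'[of "1 / 2" 0 "1 / \<sigma>"] \<sigma> by (auto simp: \<rho>_def)
  have \<rho>pow: "\<rho> ^ n = (1 / 2) powr (real n / \<sigma>)" for n
    by (simp add: \<rho>_def powr_realpow[symmetric] powr_powr)
  have h_range: "h y - c \<in> {h 0 - C - c..h 0 + C - c}" if "y \<in> {0..<1}" for y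
    using contract[of 0 0 y 0] that by (simp add: abs_le_iff)
  obtain D where D: "\<And>x. x \<in> {h 0 - C - c..h 0 + C - c} \<Longrightarrow> \<bar>(deriv ^^ Suc k) f x\<bar> \<le> D"
    using jet_continuous_bound[OF f] by blast
  have "0 \<le> D" using D[of "h 0 - c"] \<open>C > 0\<close> by (meson abs_ge_zero atLeastAtMost_iff h_range order_refl order_trans zero_less_one atLeastLessThan_iff)
  have close: "cc_dist k (\<psi> y) (\<psi> y') \<le> ennreal (2 * (1 + D) * \<bar>h y' - h y\<bar>)" if "y \<in> {0..<1}" "y' \<in> {0..<1}" for y y'
  proof -
    have "closed_segment (h y - c) (h y' - c) \<subseteq> {h 0 - C - c..h 0 + C - c}"
      using h_range that by (intro closed_segment_subset) auto
    then have "cc_dist k (jet k f (h y - c)) (jet k f (h y' - c)) \<le>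
        ennreal (2 * (1 + D) * (\<bar>(h y' - c) - (h y - c)\<bar> + \<bar>(h y' - c) - (h y' - c)\<bar>))"
      using h_range[OF that(2)] by (intro cc_dist_broken_jet_le f refl D) auto
    then show ?thesis by (simp add: \<psi>_def)
  qed
  have "hausdorff_measure (jet_space k) (cc_dist k) s (\<psi> ` {0..<1}) = 0" if "s > \<sigma>" for s
  proof (rule hausdorff_measure_eq_0I[where \<rho> = \<rho> and K = "2 * (1 + D) * C" and M = "2 ^ 1"])
    show "real (2 ^ 1) * \<rho> powr s < 1" unfolding \<rho>_def using \<sigma> that by (intro half_powr_sum_less_1) auto
    fix n
    define I where "I a = {real a / 2 ^ n..<(real a + 1) / 2 ^ n}" for a :: nat
    define \<U> where "\<U> = (\<lambda>a. \<psi> ` I a) ` {..<2 ^ n}"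
    have "card \<U> \<le> (2 ^ 1) ^ n" unfolding \<U>_def using card_image_le[of "{..<2 ^ n :: nat}"] by simp
    moreover have "\<psi> ` {0..<1} \<subseteq> \<Union>\<U>"
    proof
      fix p assume "p \<in> \<psi> ` {0..<1}"
      then obtain y where y: "y \<in> {0..<1}" "p = \<psi> y" by blast
      obtain a where "a < 2 ^ n" "y \<in> I a" using dyadic_interval[OF y(1)] unfolding I_def by metis
      then show "p \<in> \<Union>\<U>" unfolding \<U>_def y(2) by blast
    qed
    moreover have "diam_wrt (cc_dist k) (\<psi> ` I a) \<le> ennreal (2 * (1 + D) * C * \<rho> ^ n)" if a: "a < 2 ^ n" for a
    proof (rule diam_wrt_le)
      fix p q assume "p \<in> \<psi> ` I a" "q \<in> \<psi> ` I a"
      then obtain y y' where y: "y \<in> I a" "y' \<in> I a" "p = \<psi> y" "q = \<psi> y'" by blast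
      then have "y \<in> {0..<1}" "y' \<in> {0..<1}" using dyadic_interval_subset[OF a] unfolding I_def by blast+
      then have "cc_dist k p q \<le> ennreal (2 * (1 + D) * \<bar>h y' - h y\<bar>)" unfolding y by (rule close)
      also have "\<dots> \<le> ennreal (2 * (1 + D) * (C * \<rho> ^ n))"
        unfolding \<rho>pow using y \<open>0 \<le> D\<close> unfolding I_def
        by (intro ennreal_leI mult_left_mono contract[OF a]) auto
      finally show "cc_dist k p q \<le> ennreal (2 * (1 + D) * C * \<rho> ^ n)" by (simp add: mult.assoc)
    qed
    ultimately show "\<exists>\<U>. finite \<U> \<and> card \<U> \<le> (2 ^ 1) ^ n \<and> \<psi> ` {0..<1} \<subseteq> \<Union>\<U> \<and>
      (\<forall>U\<in>\<U>. U \<subseteq> jet_space k \<and> diam_wrt (cc_dist k) U \<le> ennreal (2 * (1 + D) * C * \<rho> ^ n))"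
      by (intro exI[of _ \<U>]) (auto simp: \<U>_def \<psi>_def jet_in_jet_space)
  qed (use \<rho> \<sigma> that \<open>C > 0\<close> \<open>0 \<le> D\<close> in auto)
  moreover have "hausdorff_measure (jet_space k) (cc_dist k) s (\<psi> ` {0..<1}) \<noteq> 0" if s: "0 \<le> s" "s < \<sigma>" for s
  proof (rule hausdorff_measure_neq_0I[where M = lborel and T = "{0..<1}" and \<psi> = \<psi> and K = 4 and t = \<sigma>])
    fix V r assume V: "V \<subseteq> {0..<1}" "0 \<le> r" "diam_wrt (cc_dist k) (\<psi> ` V) \<le> ennreal r"
    show "\<exists>B\<in>sets lborel. V \<subseteq> B \<and> emeasure lborel B \<le> ennreal (4 * r powr \<sigma>)"
    proof (cases "V = {}")
      case False
      then obtain y0 where y0: "y0 \<in> V" by blast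
      have "\<bar>y - y0\<bar> \<le> 2 * r powr \<sigma>" if "y \<in> V" for y
      proof -
        have "cc_dist k (\<psi> y) (\<psi> y0) \<le> ennreal r"
          using le_diam_wrt[of "\<psi> y" "\<psi> ` V" "\<psi> y0" "cc_dist k"] that y0 V(3) by (auto intro: order_trans)
        then have "\<bar>h y - h y0\<bar> \<le> r" using fst_diff_le_cc_dist[OF _ V(2)] by (fastforce simp: \<psi>_def jet_def)
        then have "2 * \<bar>h y - h y0\<bar> powr \<sigma> \<le> 2 * r powr \<sigma>" using \<sigma> by (intro mult_left_mono powr_mono2) auto
        moreover have "y \<in> {0..<1}" "y0 \<in> {0..<1}" using that y0 V(1) by auto
        ultimately show ?thesis using expand[of y y0] by linarith
      qed
      then have "V \<subseteq> {y0 - 2 * r powr \<sigma>..y0 + 2 * r powr \<sigma>}" by (auto simp: abs_le_iff algebra_simps)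
      then show ?thesis by (intro bexI[of _ "{y0 - 2 * r powr \<sigma>..y0 + 2 * r powr \<sigma>}"]) auto
    qed (auto intro!: bexI[of _ "{}"])
  qed (use s in auto)
  ultimately show ?thesis by (simp add: has_hausdorff_dim_def \<psi>_def[abs_def])
qed

text \<open>At stage \<open>n\<close> the coordinate \<open>u\<^sub>j\<close> is subdivided at dyadic level \<open>n * (k + 1 - j)\<close>, so that all
  coordinates contribute the same order \<open>\<rho> ^ n\<close> to the distance, and \<open>2 ^ (n * N)\<close> boxes are needed,
  where \<open>N\<close> is the sum of the weights. Conversely the parameters of a set of diameter \<open>r\<close> lie in a box
  with sides of order \<open>r powr ((k + 1 - j) * \<sigma>)\<close>, hence of volume of order \<open>r powr (N * \<sigma>)\<close>.\<close>

lemma has_hausdorff_dim_fiber_product: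
  fixes h :: "real \<Rightarrow> real" and k :: nat
  assumes \<sigma>: "0 < \<sigma>" and h: "staircase \<sigma> C h"
  defines "\<phi> \<equiv> \<lambda>y. (0 :: real, \<lambda>j. if j \<le> k then h (y j) else 0)"
  shows "has_hausdorff_dim (jet_space k) (cc_dist k) (\<phi> ` (PiE {..k} (\<lambda>_. {0..<1})))
    (real (\<Sum>j\<le>k. k + 1 - j) * \<sigma>)"
proof -
  note expand = staircaseD(3)[OF h] and contract = staircaseD(4)[OF h]
  have "C > 0" using h by (rule staircaseD)
  define N where "N = (\<Sum>j\<le>k. k + 1 - j)"
  define T :: "(nat \<Rightarrow> real) set" where "T = PiE {..k} (\<lambda>_. {0..<1})"
  define \<rho> :: real where "\<rho> = (1 / 2) powr (1 / \<sigma>)"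
  have \<rho>: "0 < \<rho>" "\<rho> < 1"
    using powr_less_mono'[of "1 / 2" 0 "1 / \<sigma>"] \<sigma> by (auto simp: \<rho>_def)
  have \<rho>pow: "\<rho> ^ n = (1 / 2) powr (real n / \<sigma>)" for n
    by (simp add: \<rho>_def powr_realpow[symmetric] powr_powr)
  have \<phi>_jet: "\<phi> y \<in> jet_space k" for y by (simp add: \<phi>_def jet_space_def)
  obtain K where K: "K > 0" and K': "\<forall>u v r. 0 < r \<longrightarrow> (0, u) \<in> jet_space k \<longrightarrow> (0, v) \<in> jet_space k \<longrightarrow>
     (\<forall>j\<le>k. \<bar>u j - v j\<bar> \<le> r ^ (k + 1 - j)) \<longrightarrow> cc_dist k (0, u) (0, v) \<le> ennreal (K * r)"
    using cc_dist_fiber_le[of k] by blast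
  \<comment> \<open>A constant at least \<open>1\<close> survives being raised to the different weights.\<close>
  define C' where "C' = max C 1"
  have C': "C' \<ge> 1" "C' \<ge> C" by (auto simp: C'_def)
  have "hausdorff_measure (jet_space k) (cc_dist k) s (\<phi> ` T) = 0" if s: "s > real N * \<sigma>" for s
  proof (rule hausdorff_measure_eq_0I[where \<rho> = \<rho> and K = "K * C'" and M = "2 ^ N"])
    show "real (2 ^ N) * \<rho> powr s < 1" unfolding \<rho>_def using \<sigma> s by (intro half_powr_sum_less_1) auto
    show "0 < s" using s \<sigma> by (metis le_less_trans less_imp_le mult_nonneg_nonneg of_nat_0_le_iff)
    fix n
    define m where "m j = n * (k + 1 - j)" for j
    define I where "I j a = {real a / 2 ^ m j..<(real a + 1) / 2 ^ m j}" for j and a :: nat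
    define A where "A = PiE {..k} (\<lambda>j. {..<2 ^ m j :: nat})"
    define \<U> where "\<U> = (\<lambda>a. \<phi> ` PiE {..k} (\<lambda>j. I j (a j))) ` A"
    have "finite A" unfolding A_def by (intro finite_PiE) auto
    have "card A = (\<Prod>j\<le>k. 2 ^ m j)" unfolding A_def by (subst card_PiE) auto
    also have "\<dots> = 2 ^ (\<Sum>j\<le>k. m j)" by (rule power_sum[symmetric])
    also have "(\<Sum>j\<le>k. m j) = N * n" by (simp add: m_def N_def sum_distrib_left[symmetric] mult.commute)
    finally have "card A = (2 ^ N) ^ n" by (simp only: power_mult)
    then have "card \<U> \<le> (2 ^ N) ^ n" unfolding \<U>_def using card_image_le[OF \<open>finite A\<close>] by metis
    moreover have "\<phi> ` T \<subseteq> \<Union>\<U>"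
    proof
      fix p assume "p \<in> \<phi> ` T"
      then obtain y where y: "y \<in> T" "p = \<phi> y" by blast
      have "\<exists>a. a < 2 ^ m j \<and> y j \<in> I j a" if "j \<le> k" for j
        using dyadic_interval[of "y j" "m j"] y(1) that unfolding I_def T_def by (metis PiE_mem atMost_iff)
      then obtain a where a: "\<And>j. j \<le> k \<Longrightarrow> a j < 2 ^ m j \<and> y j \<in> I j (a j)" by metis
      have "restrict a {..k} \<in> A" using a by (auto simp: A_def)
      moreover have "y \<in> PiE {..k} (\<lambda>j. I j (restrict a {..k} j))" using a y(1) by (auto simp: T_def PiE_iff)
      ultimately show "p \<in> \<Union>\<U>" unfolding \<U>_def y(2) by blast
    qed
    moreover have "diam_wrt (cc_dist k) (\<phi> ` PiE {..k} (\<lambda>j. I j (a j))) \<le> ennreal (K * C' * \<rho> ^ n)" if a: "a \<in> A" for a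
    proof (rule diam_wrt_le)
      fix p q assume "p \<in> \<phi> ` PiE {..k} (\<lambda>j. I j (a j))" "q \<in> \<phi> ` PiE {..k} (\<lambda>j. I j (a j))"
      then obtain y y' where y: "y \<in> PiE {..k} (\<lambda>j. I j (a j))" "y' \<in> PiE {..k} (\<lambda>j. I j (a j))" "p = \<phi> y" "q = \<phi> y'" by blast
      have "\<bar>h (y j) - h (y' j)\<bar> \<le> (C' * \<rho> ^ n) ^ (k + 1 - j)" if j: "j \<le> k" for j
      proof -
        have "a j < 2 ^ m j" using a j by (auto simp: A_def)
        then have "\<bar>h (y j) - h (y' j)\<bar> \<le> C * (1 / 2) powr (real (m j) / \<sigma>)"
          using y j by (intro contract) (auto simp: I_def PiE_iff)
        also have "\<dots> = C * \<rho> ^ m j" by (simp only: \<rho>pow)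
        also have "\<dots> \<le> C' ^ (k + 1 - j) * \<rho> ^ m j"
        proof (rule mult_right_mono)
          have "C' ^ 1 \<le> C' ^ (k + 1 - j)" using C' j by (intro power_increasing) auto
          then show "C \<le> C' ^ (k + 1 - j)" using C' by simp
        qed (use \<rho> in auto)
        also have "\<dots> = (C' * \<rho> ^ n) ^ (k + 1 - j)" by (simp only: power_mult_distrib m_def power_mult)
        finally show ?thesis .
      qed
      then have "cc_dist k p q \<le> ennreal (K * (C' * \<rho> ^ n))"
        unfolding y(3,4) \<phi>_def using C' \<rho> \<phi>_jet[of y] \<phi>_jet[of y'] by (intro K'[rule_format]) (auto simp: \<phi>_def)
      then show "cc_dist k p q \<le> ennreal (K * C' * \<rho> ^ n)" by (simp add: mult.assoc)
    qed
    ultimately show "\<exists>\<U>. finite \<U> \<and> card \<U> \<le> (2 ^ N) ^ n \<and> \<phi> ` T \<subseteq> \<Union>\<U> \<and>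
      (\<forall>U\<in>\<U>. U \<subseteq> jet_space k \<and> diam_wrt (cc_dist k) U \<le> ennreal (K * C' * \<rho> ^ n))"
      using \<open>finite A\<close> by (intro exI[of _ \<U>]) (auto simp: \<U>_def \<phi>_jet)
  qed (use \<rho> C' K in auto)
  moreover have "hausdorff_measure (jet_space k) (cc_dist k) s (\<phi> ` T) \<noteq> 0" if s: "0 \<le> s" "s < real N * \<sigma>" for s
  proof (rule hausdorff_measure_neq_0I[where M = "PiM {..k} (\<lambda>_. lborel)" and T = T and \<psi> = \<phi> and K = "4 ^ (k + 1)" and t = "real N * \<sigma>"])
    interpret product_sigma_finite "\<lambda>_ :: nat. lborel :: real measure" by standard
    show "T \<in> sets (PiM {..k} (\<lambda>_. lborel))" unfolding T_def by (intro sets_PiM_I_finite) auto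
    have "emeasure (PiM {..k} (\<lambda>_. lborel)) T = (\<Prod>j\<le>k. emeasure lborel {0..<1 :: real})"
      unfolding T_def by (intro emeasure_PiM) auto
    then show "emeasure (PiM {..k} (\<lambda>_. lborel)) T \<noteq> 0" by simp
    fix V r assume V: "V \<subseteq> T" "0 \<le> r" "diam_wrt (cc_dist k) (\<phi> ` V) \<le> ennreal r"
    show "\<exists>B\<in>sets (PiM {..k} (\<lambda>_. lborel)). V \<subseteq> B \<and>
        emeasure (PiM {..k} (\<lambda>_. lborel)) B \<le> ennreal (4 ^ (k + 1) * r powr (real N * \<sigma>))"
    proof (cases "V = {}")
      case False
      then obtain y0 where y0: "y0 \<in> V" by blast
      define l where "l j = 2 * (r ^ (k + 1 - j)) powr \<sigma>" for j
      define B where "B = PiE {..k} (\<lambda>j. {y0 j - l j..y0 j + l j})"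
      have "\<bar>y j - y0 j\<bar> \<le> l j" if y: "y \<in> V" and j: "j \<le> k" for y j
      proof -
        have "cc_dist k (\<phi> y) (\<phi> y0) \<le> ennreal r"
          using le_diam_wrt[of "\<phi> y" "\<phi> ` V" "\<phi> y0" "cc_dist k"] y y0 V(3) by (auto intro: order_trans)
        then have "\<bar>snd (\<phi> y) j - snd (\<phi> y0) j\<bar> \<le> r ^ (k + 1 - j)"
          using j V(2) by (intro fiber_diff_le_cc_dist) (auto simp: \<phi>_def)
        then have "\<bar>h (y j) - h (y0 j)\<bar> \<le> r ^ (k + 1 - j)" using j by (simp add: \<phi>_def)
        then have "2 * \<bar>h (y j) - h (y0 j)\<bar> powr \<sigma> \<le> l j"
          unfolding l_def using \<sigma> by (intro mult_left_mono powr_mono2) auto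
        moreover have "y j \<in> {0..<1}" "y0 j \<in> {0..<1}" using y y0 V(1) j by (auto simp: T_def PiE_iff subset_iff)
        ultimately show ?thesis using expand[of "y j" "y0 j"] by linarith
      qed
      then have "V \<subseteq> B"
        using V(1) by (fastforce simp: B_def T_def PiE_iff abs_le_iff algebra_simps)
      moreover have "B \<in> sets (PiM {..k} (\<lambda>_. lborel))" unfolding B_def by (intro sets_PiM_I_finite) auto
      moreover have "emeasure (PiM {..k} (\<lambda>_. lborel)) B = ennreal (4 ^ (k + 1) * r powr (real N * \<sigma>))"
      proof -
        have "emeasure (PiM {..k} (\<lambda>_. lborel)) B = (\<Prod>j\<le>k. emeasure lborel {y0 j - l j..y0 j + l j})"
          unfolding B_def by (intro emeasure_PiM) auto
        also have "\<dots> = (\<Prod>j\<le>k. ennreal (4 * r powr (real (k + 1 - j) * \<sigma>)))"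
        proof (rule prod.cong)
          fix j assume "j \<in> {..k}"
          then have "(r ^ (k + 1 - j)) powr \<sigma> = r powr (real (k + 1 - j) * \<sigma>)"
            using V(2) by (cases "r = 0") (auto simp: powr_powr powr_realpow[symmetric])
          then show "emeasure lborel {y0 j - l j..y0 j + l j} = ennreal (4 * r powr (real (k + 1 - j) * \<sigma>))"
            by (simp add: l_def)
        qed simp
        also have "\<dots> = ennreal (\<Prod>j\<le>k. 4 * r powr (real (k + 1 - j) * \<sigma>))"
          by (rule prod_ennreal) simp
        also have "(\<Prod>j\<le>k. 4 * r powr (real (k + 1 - j) * \<sigma>)) = 4 ^ (k + 1) * r powr (real N * \<sigma>)"
        proof (cases "r = 0")
          case False
          have "real N * \<sigma> = (\<Sum>j\<le>k. real (k + 1 - j) * \<sigma>)" by (simp add: N_def sum_distrib_right)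
          then show ?thesis using False by (simp add: prod.distrib powr_sum)
        qed (auto simp: prod.distrib)
        finally show ?thesis .
      qed
      ultimately show ?thesis by (intro bexI[of _ B]) auto
    qed (auto intro!: bexI[of _ "{}"])
  qed (use s in auto)
  ultimately show ?thesis by (simp add: has_hausdorff_dim_def N_def T_def)
qed

lemma sum_weights: "real (\<Sum>j\<le>k. k + 1 - j) = real ((k + 1) * (k + 2)) / 2"
proof (induction k)
  case (Suc k)
  have "(\<Sum>j\<le>Suc k. Suc k + 1 - j) = Suc k + 1 + (\<Sum>j\<le>k. k + 1 - j)"
    by (subst sum.atMost_Suc_shift) simp
  then show ?case using Suc by (simp add: field_simps)
qed simp

lemma has_hausdorff_dim_singleton:
  assumes "p \<in> X" "d p p = 0"
  shows "has_hausdorff_dim X d {p} 0"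
proof -
  have "diam_wrt d {p} = 0" using assms by (simp add: diam_wrt_def)
  then have "hausdorff_measure X d s {p} = 0" if "0 < s" for s
    by (intro hausdorff_measure_eq_0I[where \<rho> = "1 / 2" and K = 0 and M = 1])
       (use assms that powr_less_mono'[of "1 / 2" 0 s] in \<open>auto intro!: exI[of _ "{{p}}"]\<close>)
  then show ?thesis by (simp add: has_hausdorff_dim_def)
qed

text \<open>One set \<open>S\<close> serves for all \<open>f\<close> and all translations \<open>c\<close>: it is used with \<open>f\<close> itself for the image and
  with the zero function for the set \<open>E1\<close>. Containing \<open>0\<close> ensures that points over \<open>0\<close> do not enlarge
  the image.\<close>

lemma jet_curve_subset_exists:
  assumes "0 \<le> \<alpha>" "\<alpha> \<le> 1"
  shows "\<exists>S. 0 \<in> S \<and> (\<forall>f c. smooth f \<longrightarrow>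
    has_hausdorff_dim (jet_space k) (cc_dist k) ((\<lambda>x. jet k f (x - c)) ` S) \<alpha>)"
proof (cases "\<alpha> = 0")
  case True
  show ?thesis
  proof (intro exI[of _ "{0}"] conjI allI impI)
    fix f c assume f: "smooth f"
    have "cc_dist k (jet k f (- c)) (jet k f (- c)) \<le> ennreal 0"
      using cc_dist_broken_jet_le[OF f f refl, of "- c" "- c" k "\<bar>(deriv ^^ Suc k) f (- c)\<bar>" "- c"] by simp
    then show "has_hausdorff_dim (jet_space k) (cc_dist k) ((\<lambda>x. jet k f (x - c)) ` {0}) \<alpha>"
      using True by (simp add: has_hausdorff_dim_singleton jet_in_jet_space)
  qed simp
next
  case False
  then have \<alpha>: "0 < \<alpha>" using assms by simp
  obtain h C where h: "staircase \<alpha> C h" using staircase_exists[OF \<alpha> assms(2)] by blast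
  show ?thesis
  proof (intro exI[of _ "h ` {0..<1}"] conjI allI impI)
    show "0 \<in> h ` {0..<1}" using staircaseD(1)[OF h] by (intro image_eqI[of _ _ 0]) auto
    fix f c assume f: "smooth f"
    show "has_hausdorff_dim (jet_space k) (cc_dist k) ((\<lambda>x. jet k f (x - c)) ` h ` {0..<1}) \<alpha>"
      unfolding image_image by (rule has_hausdorff_dim_jet_image[OF \<alpha> h f])
  qed
qed

lemma fiber_subset_exists:
  assumes "0 < \<mu>" "\<mu> \<le> real ((k + 1) * (k + 2)) / 2"
  shows "\<exists>E\<subseteq>jet_space k. (\<forall>p\<in>E. fst p = 0) \<and> has_hausdorff_dim (jet_space k) (cc_dist k) E \<mu>"
proof -
  define N where "N = real (\<Sum>j\<le>k. k + 1 - j)"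
  define \<sigma> where "\<sigma> = \<mu> / N"
  have N: "N = real ((k + 1) * (k + 2)) / 2" unfolding N_def by (rule sum_weights)
  have "0 < real ((k + 1) * (k + 2))" by (simp only: of_nat_0_less_iff) simp
  then have "0 < N" unfolding N by (rule half_gt_zero)
  then have \<sigma>: "0 < \<sigma>" "\<sigma> \<le> 1" "N * \<sigma> = \<mu>"
    using assms(1) assms(2)[folded N] \<open>0 < N\<close> by (auto simp: \<sigma>_def)
  obtain h C where h: "staircase \<sigma> C h" using staircase_exists[OF \<sigma>(1,2)] by blast
  let ?E = "(\<lambda>y. (0 :: real, \<lambda>j. if j \<le> k then h (y j) else 0)) ` (PiE {..k} (\<lambda>_. {0..<1}))"
  have "has_hausdorff_dim (jet_space k) (cc_dist k) ?E \<mu>"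
    using has_hausdorff_dim_fiber_product[OF \<sigma>(1) h, of k, folded N_def, unfolded \<sigma>(3)] .
  then show ?thesis by (intro exI[of _ ?E]) (auto simp: jet_space_def)
qed

theorem proposition5p1:
  fixes k :: nat and t :: real and f :: "real \<Rightarrow> real" and \<alpha> \<mu> :: real
  assumes "k \<ge> 1"
    and "smooth f"
    and "0 \<le> \<alpha>" and "\<alpha> \<le> 1"
    and "\<alpha> \<le> \<mu>" and "\<mu> \<le> real ((k + 1) * (k + 2)) / 2"
  shows "\<exists>E \<subseteq> jet_space k.
           jet_hausdorff_dim k (horizontal_map k f t ` E) = ennreal \<alpha> \<and>
           jet_hausdorff_dim k E = ennreal \<mu>"
proof -
  have "poly (0 :: real poly) = (\<lambda>_. 0)" by (simp add: fun_eq_iff)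
  then have zero: "smooth (\<lambda>_. 0)" using smooth_poly[of 0] by simp
  obtain S where S: "0 \<in> S"
    "\<forall>f c. smooth f \<longrightarrow> has_hausdorff_dim (jet_space k) (cc_dist k) ((\<lambda>x. jet k f (x - c)) ` S) \<alpha>"
    using jet_curve_subset_exists[OF assms(3,4)] by blast
  define E1 where "E1 = (\<lambda>x. jet k (\<lambda>_. 0) (x - 0)) ` S"
  have E1: "E1 \<subseteq> jet_space k" "fst ` E1 = S" "has_hausdorff_dim (jet_space k) (cc_dist k) E1 \<alpha>"
    using S(2)[rule_format, OF zero, of 0] jet_in_jet_space by (auto simp: E1_def jet_def image_image)
  obtain E2 where E2: "E2 \<subseteq> jet_space k" "\<And>p. p \<in> E2 \<Longrightarrow> fst p = 0"
    "has_hausdorff_dim (jet_space k) (cc_dist k) (E1 \<union> E2) \<mu>"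
    \<comment> \<open>If \<open>\<mu> = 0\<close> then also \<open>\<alpha> = 0\<close>, and \<open>E1\<close> alone has the required dimension.\<close>
  proof (cases "\<mu> = 0")
    case True
    then show ?thesis using E1 assms by (intro that[of "{}"]) auto
  next
    case False
    then have "0 < \<mu>" using assms by simp
    then obtain E2 where "E2 \<subseteq> jet_space k" "\<forall>p\<in>E2. fst p = 0"
      "has_hausdorff_dim (jet_space k) (cc_dist k) E2 \<mu>"
      using fiber_subset_exists[OF _ assms(6)] by blast
    then show ?thesis using has_hausdorff_dim_Un[OF E1(3) _ assms(5)] by (intro that[of E2]) auto
  qed
  have "fst ` (E1 \<union> E2) = S" using E1(2) E2(2) S(1) by (auto simp: image_Un)
  then have "horizontal_map k f t ` (E1 \<union> E2) = (\<lambda>x. jet k f (x - t)) ` S"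
    by (metis (no_types, lifting) horizontal_map_def image_cong image_image)
  then have "jet_hausdorff_dim k (horizontal_map k f t ` (E1 \<union> E2)) = ennreal \<alpha>"
    using S(2)[rule_format, OF assms(2)] assms(3) by (simp add: hausdorff_dim_eqI)
  moreover have "jet_hausdorff_dim k (E1 \<union> E2) = ennreal \<mu>"
    using E2(3) assms by (intro hausdorff_dim_eqI) auto
  ultimately show ?thesis using E1(1) E2(1) by (intro exI[of _ "E1 \<union> E2"]) auto
qed

end
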